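(* For every $p \in (1,2)$ there exists a constant $C_p>0$ such that for all positive integers $N$, all intervals $E \subset \mathbb{Z}$ of length $N$, and all functions $f$ on $\mathbb{Z}$ supported on $E$, there holds $$\langle K_N f \rangle_{E,p'} \leq C_p \, \langle f \rangle_{E,p}.$$
   Context: Let $d(n)=\sum_{k\mid n}1$ be the divisor function (number of positive divisors of $n$), and $D(N)=\sum_{n=1}^N d(n)$. For a function $f$ on the integers, define $$K_N f(x)=\frac{1}{D(N)}\sum_{n=1}^{N} d(n)\, f(x+n),\qquad x\in\mathbb{Z}.$$ Intervals are finite sets of consecutive integers, and the length $|I|$ of an interval $I$ is its number of elements. For an interval $I\subset\mathbb{Z}$ and $1\le p<\infty$, write $$\langle f\rangle_{I,p}=\Big(\frac{1}{|I|}\sum_{x\in I}|f(x)|^p\Big)^{1/p}.$$ The conjugate exponent $p'$ of $p$ is defined by $\frac1p+\frac1{p'}=1$. *)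

theory Defs
  imports "HOL-Analysis.Analysis"
begin

definition divisor_count :: "nat \<Rightarrow> nat" where
  "divisor_count n = card {k. k dvd n}"

definition divisor_summatory :: "nat \<Rightarrow> nat" where
  "divisor_summatory N = (\<Sum>n = 1..N. divisor_count n)"

definition divisor_average :: "nat \<Rightarrow> (int \<Rightarrow> complex) \<Rightarrow> int \<Rightarrow> complex" where
  "divisor_average N f x =
     (1 / of_nat (divisor_summatory N)) * (\<Sum>n = 1..N. of_nat (divisor_count n) * f (x + int n))"

(* The empty set counts as an interval here; demanding positive length excludes it. *)
definition integer_interval :: "int set \<Rightarrow> bool" where
  "integer_interval I \<longleftrightarrow> (\<exists>a b. I = {a..b})"

(* The real power powr satisfies 0 powr p = 0, so for p > 0 zeros of f contribute nothing,
   as they should. *)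
definition lp_average :: "(int \<Rightarrow> complex) \<Rightarrow> int set \<Rightarrow> real \<Rightarrow> real" where
  "lp_average f I p = ((1 / real (card I)) * (\<Sum>x\<in>I. cmod (f x) powr p)) powr (1 / p)"

end

theory Submission
  imports Defs
begin

text \<open>
By duality and positivity, the claim is a bound for the bilinear form \<open>\<Sum> d(y - x) g(x) f(y)\<close> over pairs
\<open>x < y\<close> in an interval of length \<open>N\<close>. Interpolating between the trivial \<open>l\<^sup>1\<close> and \<open>l\<^sup>2\<close> bounds
would lose a power of the ratio of the maximum of \<open>d\<close> to its average, which is unbounded. Since the interval carries a probability measure, it is enough to show, for
indicator functions of sets of densities \<open>\<alpha>\<close> and \<open>\<beta>\<close> and every \<open>\<epsilon> > 0\<close>, that the form is at most
\<open>C * N\<^sup>2 * log N * (\<alpha> * \<beta>) powr (1 - \<epsilon>)\<close> (\<open>restricted_estimate\<close>); a dyadic decomposition of \<open>f\<close> and \<open>g\<close>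
does the rest (\<open>divisor_form_bounded\<close>), and the factor \<open>log N\<close> is, up to constants, the average of \<open>d\<close>
(\<open>divisor_summatory_ge\<close>).

If \<open>\<alpha> * \<beta>\<close> is below a small negative power of \<open>N\<close>, the bound \<open>d(n) = O(n powr \<eta>)\<close> is enough. For denser
sets, \<open>d(n)\<close> is at most twice the number of divisors \<open>k \<le> sqrt N\<close> of \<open>n\<close>, and the Cauchy-Schwarz
inequality within residue classes leaves the task of counting, for a single set \<open>F\<close> of density \<open>\<alpha>\<close>,
the triples \<open>(k, x, y)\<close> with \<open>k \<le> sqrt N\<close>, \<open>x, y \<in> F\<close> and \<open>k\<close> dividing \<open>x - y\<close>. On the Fourier side this is
a sum of \<open>\<bar>S(b / q)\<bar>\<^sup>2\<close> over reduced fractions with \<open>q \<le> sqrt N\<close>, where \<open>S\<close> is the exponential sum of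
\<open>F\<close>, with weights \<open>O(log N / q)\<close>. The large sieve bounds the contribution of \<open>q > Q\<close> by
\<open>log N * N\<^sup>2 * \<alpha> / Q\<close>, while the contribution of \<open>q \<le> Q\<close> is at most \<open>log N\<close> times the same count of
triples with \<open>k \<le> Q\<close> (\<open>sum_collisions_le\<close>). With \<open>Q\<close> about \<open>1 / \<alpha>\<close>, the first is \<open>log N * N\<^sup>2 * \<alpha>\<^sup>2\<close>
and the second exceeds this only by a small power of \<open>1 / \<alpha>\<close>: by Hoelder's inequality it is governed by a high
moment of the number of divisors up to \<open>Q\<close>, whose average over the interval is \<open>O(Q powr \<epsilon>)\<close>
(\<open>sum_collisions_small_moduli_le\<close>). The logarithm is lost only once, because the moments see only \<open>Q\<close>
and not \<open>N\<close>.

Throughout, \<open>harm K\<close> with \<open>K\<^sup>2 \<le> N < (K + 1)\<^sup>2\<close> plays the part of \<open>log N\<close>.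
\<close>

section \<open>The divisor bound\<close>

lemma divisor_count_prime_power_mult_le:
  assumes "prime p" and "m > 0"
  shows "divisor_count (p ^ e * m) \<le> (e + 1) * divisor_count m"
proof -
  have "{k. k dvd p ^ e * m} \<subseteq> (\<lambda>(i, k). p ^ i * k) ` ({..e} \<times> {k. k dvd m})"
  proof
    fix k assume "k \<in> {k. k dvd p ^ e * m}"
    then obtain b c where "k = b * c" "b dvd p ^ e" "c dvd m"
      using division_decomp[of k "p ^ e" m] by auto
    moreover from this obtain i where "i \<le> e" "b = p ^ i"
      using divides_primepow_nat[OF assms(1)] by auto
    ultimately show "k \<in> (\<lambda>(i, k). p ^ i * k) ` ({..e} \<times> {k. k dvd m})" by auto
  qed
  moreover have fin: "finite ({..e} \<times> {k. k dvd m})" using assms by simp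
  ultimately have "card {k. k dvd p ^ e * m} \<le> card ({..e} \<times> {k. k dvd m})"
    by (meson card_image_le card_mono finite_imageI le_trans)
  then show ?thesis by (simp add: divisor_count_def card_cartesian_product)
qed

text \<open>
Compare \<open>d(n) = \<Prod> (e + 1)\<close> with \<open>n powr \<eta> = \<Prod> p powr (\<eta> * e)\<close> one prime power at a time. As soon as
\<open>p \<ge> 2 powr (1 / \<eta>)\<close> the factor \<open>p powr (\<eta> * e)\<close> is at least \<open>2 ^ e \<ge> e + 1\<close> and costs nothing; each of
the finitely many smaller primes costs a bounded factor \<open>c\<close>.
\<close>

lemma divisor_bound:
  fixes \<eta> :: real
  assumes "\<eta> > 0"
  obtains C where "C \<ge> 1" "\<And>n. n > 0 \<Longrightarrow> real (divisor_count n) \<le> C * real n powr \<eta>"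
proof -
  \<comment> \<open>Chosen so that \<open>e + 1 \<le> c * (1 + e * \<eta> * ln 2) \<le> c * 2 powr (e * \<eta>)\<close>.\<close>
  define c where "c = max 1 (1 / (\<eta> * ln 2))"
  define B where "B = {p. prime p \<and> real p < 2 powr (1 / \<eta>)}"
  have finB: "finite B"
  proof (rule finite_subset)
    show "B \<subseteq> {..nat \<lceil>2 powr (1 / \<eta>)\<rceil>}" unfolding B_def by (auto; linarith)
  qed simp
  have c1: "c \<ge> 1" by (simp add: c_def)
  have loc: "real (e + 1) \<le> (if p \<in> B then c else 1) * real (p ^ e) powr \<eta>" if p: "prime p" for p e
  proof (cases "p \<in> B")
    case True
    have "real e \<le> c * (real e * (\<eta> * ln 2))"
    proof -
      have "1 / (\<eta> * ln 2) * (real e * (\<eta> * ln 2)) \<le> c * (real e * (\<eta> * ln 2))"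
        by (rule mult_right_mono) (use assms in \<open>auto simp: c_def\<close>)
      then show ?thesis using assms by simp
    qed
    then have "real (e + 1) \<le> c * (1 + real e * (\<eta> * ln 2))"
      using c1 by (simp add: algebra_simps)
    also have "\<dots> \<le> c * exp (real e * (\<eta> * ln 2))"
      using c1 by (intro mult_left_mono exp_ge_add_one_self) auto
    also have "exp (real e * (\<eta> * ln 2)) = real (2 ^ e) powr \<eta>"
      by (simp add: powr_def ln_realpow algebra_simps)
    also have "c * \<dots> \<le> c * real (p ^ e) powr \<eta>"
    proof -
      have "2 ^ e \<le> p ^ e" using prime_ge_2_nat[OF p] by (rule power_mono) simp
      then have "real (2 ^ e) \<le> real (p ^ e)" by (simp only: of_nat_le_iff)
      then show ?thesis using c1 assms by (intro mult_left_mono powr_mono2) auto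
    qed
    finally show ?thesis using True by simp
  next
    case False
    then have "2 powr (1 / \<eta>) \<le> real p" using p by (simp add: B_def)
    then have "(2 powr (1 / \<eta>)) powr \<eta> \<le> real p powr \<eta>" using assms by (intro powr_mono2) auto
    then have "2 \<le> real p powr \<eta>" using assms by (simp add: powr_powr)
    then have "2 ^ e \<le> (real p powr \<eta>) ^ e" by (intro power_mono) auto
    also have "(real p powr \<eta>) ^ e = real (p ^ e) powr \<eta>"
      using prime_gt_0_nat[OF p]
      by (simp add: powr_power powr_realpow[symmetric] powr_powr mult.commute)
    moreover have "e + 1 \<le> 2 ^ e" by (induct e) auto
    then have "real (e + 1) \<le> 2 ^ e" using of_nat_mono by fastforce
    ultimately show ?thesis using False by simp
  qed
  have main: "real (divisor_count n) \<le> c ^ card (B \<inter> prime_factors n) * real n powr \<eta>" if "n > 0" for n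
    using that
  proof (induction n rule: less_induct)
    case (less n)
    show ?case
    proof (cases "n = 1")
      case True
      then show ?thesis by (simp add: divisor_count_def)
    next
      case False
      then obtain p where p: "prime p" "p dvd n" using prime_factor_nat by blast
      obtain m where m: "n = p ^ multiplicity p n * m" "\<not> p dvd m"
        using multiplicity_decompose'[of n p] less.prems p by (metis less_irrefl not_prime_unit)
      define e where "e = multiplicity p n"
      have nm: "n = p ^ e * m" using m by (simp add: e_def)
      have m0: "m > 0" using m less.prems by (cases m) auto
      have e0: "e > 0" using p less.prems by (simp add: e_def prime_multiplicity_gt_zero_iff)
      have "p ^ e > 1" by (rule one_less_power[OF prime_gt_1_nat[OF p(1)] e0])
      then have mn: "m < n" using nm m0 by simp
      have pf: "prime_factors n = insert p (prime_factors m)"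
      proof -
        have "prime_factors n = prime_factors (p ^ e) \<union> prime_factors m"
          using m0 p(1) by (subst nm, subst prime_factors_product) auto
        then show ?thesis using p(1) e0 by (simp add: prime_factorization_prime_power)
      qed
      have pm: "p \<notin> prime_factors m" using m(2) by auto
      have fac: "(if p \<in> B then c else 1) * c ^ card (B \<inter> prime_factors m) = c ^ card (B \<inter> prime_factors n)"
        using pm by (auto simp: pf Int_insert_right)
      have "real (divisor_count n) \<le> real (e + 1) * real (divisor_count m)"
        using divisor_count_prime_power_mult_le[OF p(1) m0, of e] nm by (metis of_nat_mono of_nat_mult)
      also have "\<dots> \<le> ((if p \<in> B then c else 1) * real (p ^ e) powr \<eta>) *
          (c ^ card (B \<inter> prime_factors m) * real m powr \<eta>)"
        using less.IH[OF mn m0] loc[OF p(1), of e] c1 by (intro mult_mono) auto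
      also have "\<dots> = c ^ card (B \<inter> prime_factors n) * (real (p ^ e) powr \<eta> * real m powr \<eta>)"
        unfolding fac[symmetric] by (simp only: mult_ac)
      also have "real (p ^ e) powr \<eta> * real m powr \<eta> = real n powr \<eta>"
        by (subst nm) (simp add: powr_mult)
      finally show ?thesis .
    qed
  qed
  show ?thesis
  proof
    show "c ^ card B \<ge> 1" using c1 by simp
    fix n :: nat assume "n > 0"
    note main[OF this]
    also have "c ^ card (B \<inter> prime_factors n) * real n powr \<eta> \<le> c ^ card B * real n powr \<eta>"
      using c1 finB by (intro mult_right_mono power_increasing card_mono) auto
    finally show "real (divisor_count n) \<le> c ^ card B * real n powr \<eta>" .
  qed
qed

section \<open>Pairs in a common residue class\<close>

lemma sum_of_bool_eq_card:
  "finite A \<Longrightarrow> (\<Sum>x\<in>A. of_bool (P x)) = real (card {x\<in>A. P x})"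
  by (simp add: sum_of_bool_eq Collect_conj_eq)

definition collisions :: "nat \<Rightarrow> int set \<Rightarrow> int set \<Rightarrow> real" where
  "collisions k F G = (\<Sum>x\<in>F. \<Sum>y\<in>G. of_bool (int k dvd x - y))"

lemma collisions_eq_sum_classes:
  assumes "finite F" "finite G" "k > 0"
  shows "collisions k F G =
    (\<Sum>a\<in>{0..<int k}. real (card {x\<in>F. x mod int k = a}) * real (card {y\<in>G. y mod int k = a}))"
proof -
  have eq: "(of_bool (int k dvd x - y) :: real) =
      (\<Sum>a\<in>{0..<int k}. of_bool (x mod int k = a) * of_bool (y mod int k = a))" for x y
  proof -
    have "(\<Sum>a\<in>{0..<int k}. of_bool (x mod int k = a) * of_bool (y mod int k = a)) =
        (\<Sum>a\<in>{0..<int k}. if a = x mod int k then of_bool (y mod int k = a) else (0::real))"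
      by (rule sum.cong) auto
    also have "\<dots> = of_bool (y mod int k = x mod int k)"
      using assms(3) by (subst sum.delta) auto
    also have "\<dots> = of_bool (int k dvd x - y)"
      using mod_eq_dvd_iff[of x "int k" y] by auto
    finally show ?thesis by simp
  qed
  have "collisions k F G = (\<Sum>x\<in>F. \<Sum>a\<in>{0..<int k}. \<Sum>y\<in>G. of_bool (x mod int k = a) * of_bool (y mod int k = a))"
    unfolding collisions_def eq by (intro sum.cong refl sum.swap)
  also have "\<dots> = (\<Sum>a\<in>{0..<int k}. \<Sum>x\<in>F. \<Sum>y\<in>G. of_bool (x mod int k = a) * of_bool (y mod int k = a))"
    by (rule sum.swap)
  also have "\<dots> = (\<Sum>a\<in>{0..<int k}. (\<Sum>x\<in>F. of_bool (x mod int k = a)) * (\<Sum>y\<in>G. of_bool (y mod int k = a)))"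
    by (simp only: sum_product)
  finally show ?thesis using assms by (simp only: sum_of_bool_eq_card)
qed

text \<open>
Congruence modulo \<open>k\<close> is a positive semidefinite kernel, so the mixed count of two sets is controlled by
the counts of the sets with themselves. This is what lets the later Fourier analysis treat one set at
a time, through squares of absolute values.
\<close>

lemma collisions_Cauchy_Schwarz:
  assumes "finite F" "finite G"
  shows "(\<Sum>k = 1..K. collisions k F G)\<^sup>2 \<le> (\<Sum>k = 1..K. collisions k F F) * (\<Sum>k = 1..K. collisions k G G)"
proof -
  let ?I = "Sigma {1..K} (\<lambda>k. {0..<int k})"
  let ?c = "\<lambda>F (k, a). real (card {x\<in>F. x mod int k = a})"
  have *: "(\<Sum>k = 1..K. collisions k F G) = (\<Sum>i\<in>?I. ?c F i * ?c G i)"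
    if "finite F" "finite G" for F G
  proof -
    have "(\<Sum>k = 1..K. collisions k F G) = (\<Sum>k = 1..K. \<Sum>a\<in>{0..<int k}. ?c F (k, a) * ?c G (k, a))"
      using that by (intro sum.cong refl) (simp add: collisions_eq_sum_classes)
    then show ?thesis by (subst (asm) sum.Sigma) (simp_all add: case_prod_unfold)
  qed
  show ?thesis
    using Cauchy_Schwarz_ineq_sum[of "?c F" "?c G" ?I] assms by (simp only: * power2_eq_square[of "?c _ _"])
qed

section \<open>Exponential sums and the large sieve\<close>

definition exponential_sum :: "(int \<Rightarrow> real) \<Rightarrow> int set \<Rightarrow> real \<Rightarrow> complex" where
  "exponential_sum w F \<theta> = (\<Sum>x\<in>F. of_real (w x) * cis (2 * pi * \<theta> * real_of_int x))"

lemma sum_roots_of_unity: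
  assumes "k > 0"
  shows "(\<Sum>h<k. cis (2 * pi * (real h / real k) * real_of_int m)) = of_nat k * of_bool (int k dvd m)"
proof -
  define z where "z = cis (2 * pi * real_of_int m / real k)"
  have pow: "cis (2 * pi * (real h / real k) * real_of_int m) = z ^ h" for h
    unfolding z_def Complex.DeMoivre by (simp add: field_simps)
  have zk: "z ^ k = 1"
  proof -
    have "z ^ k = cis (2 * pi * real_of_int m)"
      unfolding z_def Complex.DeMoivre using assms by simp
    then show ?thesis by simp
  qed
  have z1: "z = 1 \<longleftrightarrow> int k dvd m"
  proof
    assume "z = 1"
    then have "cos (2 * pi * real_of_int m / real k) = 1" by (simp add: z_def complex_eq_iff)
    then obtain n :: int where "2 * pi * real_of_int m / real k = real_of_int n * 2 * pi"
      by (auto simp: cos_one_2pi_int)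
    then have "real_of_int m = real_of_int n * real k" using assms by (simp add: field_simps)
    then have "m = n * int k" by (metis of_int_eq_iff of_int_mult of_int_of_nat_eq)
    then show "int k dvd m" by simp
  next
    assume "int k dvd m"
    then obtain n where "m = int k * n" by (elim dvdE)
    then have "2 * pi * real_of_int m / real k = 2 * pi * real_of_int n" using assms by simp
    then show "z = 1" by (simp only: z_def cis_multiple_2pi Ints_of_int)
  qed
  have "(\<Sum>h<k. z ^ h) = of_nat k * of_bool (int k dvd m)"
    using z1 zk by (cases "z = 1") (simp_all add: geometric_sum)
  then show ?thesis by (simp only: pow)
qed

text \<open>
Parseval's identity for the integers modulo \<open>k\<close>. With \<open>w = 1\<close> it counts collisions modulo \<open>k\<close>; with
\<open>k = N\<close> and \<open>F\<close> in an interval of length \<open>N\<close> only the diagonal \<open>x = y\<close> survives.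
\<close>

lemma sum_norm_exponential_sum_squared:
  assumes "k > 0"
  shows "(\<Sum>h<k. (cmod (exponential_sum w F (real h / real k)))\<^sup>2) =
    real k * (\<Sum>x\<in>F. \<Sum>y\<in>F. of_bool (int k dvd x - y) * (w x * w y))"
proof -
  let ?c = "\<lambda>h x. cis (2 * pi * (real h / real k) * real_of_int x)"
  have c: "?c h x * cnj (?c h y) = ?c h (x - y)" for h x y
    by (simp add: cis_cnj cis_mult right_diff_distrib)
  have "complex_of_real (\<Sum>h<k. (cmod (exponential_sum w F (real h / real k)))\<^sup>2) =
      (\<Sum>h<k. exponential_sum w F (real h / real k) * cnj (exponential_sum w F (real h / real k)))"
    by (simp only: of_real_sum complex_norm_square)
  also have "\<dots> = (\<Sum>h<k. \<Sum>x\<in>F. \<Sum>y\<in>F. of_real (w x * w y) * ?c h (x - y))"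
    unfolding exponential_sum_def cnj_sum sum_product c[symmetric]
    by (intro sum.cong refl) (simp only: complex_cnj_mult complex_cnj_complex_of_real of_real_mult mult_ac)
  also have "\<dots> = (\<Sum>x\<in>F. \<Sum>h<k. \<Sum>y\<in>F. of_real (w x * w y) * ?c h (x - y))"
    by (rule sum.swap)
  also have "\<dots> = (\<Sum>x\<in>F. \<Sum>y\<in>F. \<Sum>h<k. of_real (w x * w y) * ?c h (x - y))"
    by (intro sum.cong refl sum.swap)
  also have "\<dots> = (\<Sum>x\<in>F. \<Sum>y\<in>F. of_real (w x * w y) * (of_nat k * of_bool (int k dvd x - y)))"
    by (simp only: sum_distrib_left[symmetric] sum_roots_of_unity[OF assms])
  also have "\<dots> = complex_of_real (real k * (\<Sum>x\<in>F. \<Sum>y\<in>F. of_bool (int k dvd x - y) * (w x * w y)))"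
    by (auto simp: sum_distrib_left mult_ac of_bool_def intro!: sum.cong)
  finally show ?thesis by (simp only: of_real_eq_iff)
qed

lemma collisions_eq_sum_exponential_sum:
  assumes "k > 0"
  shows "collisions k F F = (\<Sum>h<k. (cmod (exponential_sum (\<lambda>_. 1) F (real h / real k)))\<^sup>2) / real k"
  using assms by (simp add: sum_norm_exponential_sum_squared collisions_def)

lemma Parseval_interval:
  assumes "N > 0" "F \<subseteq> {a..<a + int N}"
  shows "(\<Sum>h<N. (cmod (exponential_sum w F (real h / real N)))\<^sup>2) = real N * (\<Sum>x\<in>F. (w x)\<^sup>2)"
proof -
  have fin: "finite F" using assms(2) finite_subset by blast
  have "of_bool (int N dvd x - y) * (w x * w y) = (if x = y then (w x)\<^sup>2 else 0)" if "x \<in> F" "y \<in> F" for x y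
  proof -
    have "\<bar>x - y\<bar> < int N" using that assms(2) by (auto simp: subset_iff abs_less_iff; smt (verit))
    then have "int N dvd x - y \<longleftrightarrow> x = y" using dvd_imp_le_int[of "x - y" "int N"] by auto
    then show ?thesis by (simp add: power2_eq_square)
  qed
  then have "(\<Sum>x\<in>F. \<Sum>y\<in>F. of_bool (int N dvd x - y) * (w x * w y)) = (\<Sum>x\<in>F. (w x)\<^sup>2)"
    using fin by (simp add: sum.delta)
  then show ?thesis using sum_norm_exponential_sum_squared[OF assms(1)] by simp
qed

text \<open>
The large sieve inequality, for points of the circle of which no two lie in the same cell
\<open>[j / N, (j + 1) / N)\<close>. For the points \<open>j / N\<close> themselves it is Parseval's identity. A general point is
\<open>\<theta> = (j + s) / N\<close> with \<open>0 \<le> s < 1\<close>; with \<open>v = (x - a) / N \<in> [0, 1)\<close> the character at \<open>\<theta>\<close> is, up to a factor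
of modulus 1 that does not depend on \<open>x\<close>, the character at \<open>j / N\<close> times
\<open>exp (2 \<pi> i s v) = \<Sum> (2 \<pi> i s) ^ m / m! * v ^ m\<close>. The \<open>m\<close>-th term replaces the weight \<open>w\<close> by \<open>w * v ^ m\<close>, which
is no larger, so Parseval applies to each term, and the coefficients \<open>(2 \<pi>) ^ m / m!\<close> are summable.
The Cauchy-Schwarz inequality over \<open>m\<close> yields the factor \<open>exp (2 \<pi>)\<close> twice.
\<close>

lemma large_sieve:
  fixes \<theta> :: "'i \<Rightarrow> real" and w :: "int \<Rightarrow> real"
  assumes N: "N > 0" and F: "F \<subseteq> {a..<a + int N}" and I: "finite I"
    and \<theta>: "\<And>i. i \<in> I \<Longrightarrow> 0 \<le> \<theta> i \<and> \<theta> i < 1"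
    and sep: "inj_on (\<lambda>i. \<lfloor>real N * \<theta> i\<rfloor>) I"
  shows "(\<Sum>i\<in>I. (cmod (exponential_sum w F (\<theta> i)))\<^sup>2) \<le> exp (4 * pi) * real N * (\<Sum>x\<in>F. (w x)\<^sup>2)"
proof -
  have fin: "finite F" using F finite_subset by blast
  define j where "j i = nat \<lfloor>real N * \<theta> i\<rfloor>" for i
  define s where "s i = real N * \<theta> i - real (j i)" for i
  define v where "v x = real_of_int (x - a) / real N" for x
  define Z where "Z m h = exponential_sum (\<lambda>x. w x * v x ^ m) F (real h / real N)" for m h
  define b where "b m = (2 * pi) ^ m / fact m" for m
  have floor: "int (j i) = \<lfloor>real N * \<theta> i\<rfloor>" if "i \<in> I" for i
    using \<theta>[OF that] by (simp add: j_def)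
  have j: "j i < N" if "i \<in> I" for i
  proof -
    have "real (j i) \<le> real N * \<theta> i" using floor[OF that] by (metis of_int_floor_le of_int_of_nat_eq)
    also have "\<dots> < real N" using \<theta>[OF that] N by simp
    finally show ?thesis by simp
  qed
  have inj: "inj_on j I"
    using sep floor unfolding inj_on_def by metis
  have s: "0 \<le> s i" "s i \<le> 1" if "i \<in> I" for i
  proof -
    have "real (j i) = of_int \<lfloor>real N * \<theta> i\<rfloor>" using floor[OF that] by (metis of_int_of_nat_eq)
    then show "0 \<le> s i" "s i \<le> 1" unfolding s_def by linarith+
  qed
  have v: "0 \<le> v x" "v x \<le> 1" if "x \<in> F" for x
  proof -
    have "0 \<le> x - a" "x - a \<le> int N" using that F by auto
    then have "0 \<le> real_of_int (x - a)" "real_of_int (x - a) \<le> real N" by linarith+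
    then show "0 \<le> v x" "v x \<le> 1" using N by (auto simp: v_def)
  qed
  have bsum: "(\<Sum>m<M. b m) \<le> exp (2 * pi)" for M
  proof -
    have "b sums exp (2 * pi)"
      using exp_converges[of "2 * pi :: real"] unfolding b_def by (simp add: field_simps)
    then show ?thesis
      using sum_le_suminf[of b "{..<M}"] by (auto simp: sums_iff b_def)
  qed
  have b0: "b m \<ge> 0" for m by (simp add: b_def)
  \<comment> \<open>The Taylor polynomials: they converge to the exponential sum, up to a factor of modulus 1.\<close>
  define T where "T M i = (\<Sum>m<M. (\<i> * of_real (2 * pi * s i)) ^ m /\<^sub>R fact m * Z m (j i))" for M i
  have lim: "(\<lambda>M. (cmod (T M i))\<^sup>2) \<longlonglongrightarrow> (cmod (exponential_sum w F (\<theta> i)))\<^sup>2" for i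
  proof -
    let ?e = "\<lambda>x. cis (2 * pi * (real (j i) / real N) * real_of_int x)"
    have T: "T M i = (\<Sum>x\<in>F. of_real (w x) * ?e x *
        (\<Sum>m<M. (\<i> * of_real (2 * pi * s i * v x)) ^ m /\<^sub>R fact m))" for M
    proof -
      have eq: "(\<i> * of_real (2 * pi * s i)) ^ m /\<^sub>R fact m * (of_real (w x * v x ^ m) * ?e x) =
          of_real (w x) * ?e x * ((\<i> * of_real (2 * pi * s i * v x)) ^ m /\<^sub>R fact m)" for m x
        by (simp add: power_mult_distrib scaleR_conv_of_real)
      then show ?thesis
        unfolding T_def Z_def exponential_sum_def sum_distrib_left by (subst sum.swap) (simp only: eq)
    qed
    have "(\<lambda>M. T M i) \<longlonglongrightarrow> (\<Sum>x\<in>F. of_real (w x) * ?e x * exp (\<i> * of_real (2 * pi * s i * v x)))"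
      unfolding T using exp_converges[unfolded sums_def] by (intro tendsto_sum tendsto_mult tendsto_const)
    also have "(\<Sum>x\<in>F. of_real (w x) * ?e x * exp (\<i> * of_real (2 * pi * s i * v x))) =
        (\<Sum>x\<in>F. of_real (w x) * cis (2 * pi * \<theta> i * real_of_int x)) * cis (- 2 * pi * s i * real_of_int a / real N)"
      unfolding sum_distrib_right cis_conv_exp[symmetric]
    proof (intro sum.cong refl)
      fix x
      have "2 * pi * (real (j i) / real N) * real_of_int x + 2 * pi * s i * v x =
          2 * pi * \<theta> i * real_of_int x + - 2 * pi * s i * real_of_int a / real N"
        using N by (simp add: s_def v_def field_simps)
      then show "of_real (w x) * ?e x * cis (2 * pi * s i * v x) =
          of_real (w x) * cis (2 * pi * \<theta> i * real_of_int x) * cis (- 2 * pi * s i * real_of_int a / real N)"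
        by (simp only: mult.assoc cis_mult)
    qed
    finally have "(\<lambda>M. T M i) \<longlonglongrightarrow> exponential_sum w F (\<theta> i) * cis (- 2 * pi * s i * real_of_int a / real N)"
      by (simp only: exponential_sum_def)
    from tendsto_power[OF tendsto_norm[OF this], of 2] show ?thesis
      by (simp add: norm_mult)
  qed
  have pt: "(cmod (T M i))\<^sup>2 \<le> exp (2 * pi) * (\<Sum>m<M. b m * (cmod (Z m (j i)))\<^sup>2)" if "i \<in> I" for M i
  proof -
    have "cmod (T M i) \<le> (\<Sum>m<M. b m * cmod (Z m (j i)))"
    proof (unfold T_def, rule order_trans[OF norm_sum sum_mono])
      fix m
      have "(2 * pi * s i) ^ m \<le> (2 * pi) ^ m" using s[OF that] by (intro power_mono) auto
      then have "(2 * pi * s i) ^ m / fact m \<le> b m" unfolding b_def by (intro divide_right_mono) auto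
      moreover have "cmod ((\<i> * of_real (2 * pi * s i)) ^ m /\<^sub>R fact m) = (2 * pi * s i) ^ m / fact m"
        using s[OF that] by (simp add: norm_power norm_mult abs_mult divide_inverse_commute)
      ultimately show "cmod ((\<i> * of_real (2 * pi * s i)) ^ m /\<^sub>R fact m * Z m (j i)) \<le> b m * cmod (Z m (j i))"
        unfolding norm_mult by (intro mult_right_mono) auto
    qed
    moreover have "sqrt (b m) * (sqrt (b m) * u) = b m * u" for m u
      using b0[of m] by (metis abs_of_nonneg mult.assoc real_sqrt_mult_self)
    ultimately have "(cmod (T M i))\<^sup>2 \<le> (\<Sum>m<M. sqrt (b m) * (sqrt (b m) * cmod (Z m (j i))))\<^sup>2"
      by (intro power_mono) (simp_all only: norm_ge_zero)
    also have "\<dots> \<le> (\<Sum>m<M. b m) * (\<Sum>m<M. b m * (cmod (Z m (j i)))\<^sup>2)"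
      using Cauchy_Schwarz_ineq_sum[of "\<lambda>m. sqrt (b m)" "\<lambda>m. sqrt (b m) * cmod (Z m (j i))" "{..<M}"]
      by (simp add: power_mult_distrib b0)
    also have "\<dots> \<le> exp (2 * pi) * (\<Sum>m<M. b m * (cmod (Z m (j i)))\<^sup>2)"
      by (intro mult_right_mono bsum sum_nonneg mult_nonneg_nonneg b0) auto
    finally show ?thesis .
  qed
  have "(\<Sum>i\<in>I. (cmod (T M i))\<^sup>2) \<le> exp (4 * pi) * real N * (\<Sum>x\<in>F. (w x)\<^sup>2)" for M
  proof -
    have Zs: "(\<Sum>i\<in>I. (cmod (Z m (j i)))\<^sup>2) \<le> real N * (\<Sum>x\<in>F. (w x)\<^sup>2)" for m
    proof -
      have "(\<Sum>i\<in>I. (cmod (Z m (j i)))\<^sup>2) = (\<Sum>h\<in>j ` I. (cmod (Z m h))\<^sup>2)"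
        using inj by (simp add: sum.reindex)
      also have "\<dots> \<le> (\<Sum>h<N. (cmod (Z m h))\<^sup>2)"
        using j by (intro sum_mono2) auto
      also have "\<dots> = real N * (\<Sum>x\<in>F. (w x * v x ^ m)\<^sup>2)"
        unfolding Z_def by (rule Parseval_interval[OF N F])
      also have "(\<Sum>x\<in>F. (w x * v x ^ m)\<^sup>2) \<le> (\<Sum>x\<in>F. (w x)\<^sup>2)"
      proof (rule sum_mono)
        fix x assume "x \<in> F"
        then have "(v x ^ m)\<^sup>2 \<le> 1" using v by (intro power_le_one) auto
        then show "(w x * v x ^ m)\<^sup>2 \<le> (w x)\<^sup>2"
          using mult_left_mono[of "(v x ^ m)\<^sup>2" 1 "(w x)\<^sup>2"] by (simp add: power_mult_distrib)
      qed
      finally show ?thesis by (simp add: mult_left_mono)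
    qed
    have "(\<Sum>i\<in>I. (cmod (T M i))\<^sup>2) \<le> (\<Sum>i\<in>I. exp (2 * pi) * (\<Sum>m<M. b m * (cmod (Z m (j i)))\<^sup>2))"
      by (rule sum_mono[OF pt])
    also have "\<dots> = exp (2 * pi) * (\<Sum>m<M. b m * (\<Sum>i\<in>I. (cmod (Z m (j i)))\<^sup>2))"
      unfolding sum_distrib_left by (rule sum.swap)
    also have "\<dots> \<le> exp (2 * pi) * (\<Sum>m<M. b m * (real N * (\<Sum>x\<in>F. (w x)\<^sup>2)))"
      by (intro mult_left_mono sum_mono Zs b0) auto
    also have "\<dots> = exp (2 * pi) * ((\<Sum>m<M. b m) * (real N * (\<Sum>x\<in>F. (w x)\<^sup>2)))"
      by (simp only: sum_distrib_right)
    also have "\<dots> \<le> exp (2 * pi) * (exp (2 * pi) * (real N * (\<Sum>x\<in>F. (w x)\<^sup>2)))"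
      by (intro mult_left_mono mult_right_mono bsum mult_nonneg_nonneg sum_nonneg) auto
    also have "\<dots> = exp (4 * pi) * real N * (\<Sum>x\<in>F. (w x)\<^sup>2)"
    proof -
      have "exp (4 * pi) = exp (2 * pi) * exp (2 * pi)" by (simp flip: exp_add)
      then show ?thesis by (simp only: mult.assoc)
    qed
    finally show ?thesis .
  qed
  then show ?thesis
    by (intro LIMSEQ_le_const2[OF tendsto_sum[OF lim]]) blast
qed

section \<open>Reduction to small moduli\<close>

lemma sum_fractions_reduced:
  fixes g :: "real \<Rightarrow> real"
  assumes "k > 0"
  shows "(\<Sum>h<k. g (real h / real k)) =
    (\<Sum>q | q dvd k. \<Sum>b | b < q \<and> coprime b q. g (real b / real q))"
proof -
  have "(\<Sum>h<k. g (real h / real k)) =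
      (\<Sum>(q, b)\<in>Sigma {q. q dvd k} (\<lambda>q. {b. b < q \<and> coprime b q}). g (real b / real q))"
  proof (rule sum.reindex_bij_witness[where i = "\<lambda>(q, b). b * (k div q)"
        and j = "\<lambda>h. (k div gcd h k, h div gcd h k)"])
    fix h assume h: "h \<in> {..<k}"
    define d where "d = gcd h k"
    have d: "d > 0" using assms by (simp add: d_def)
    obtain b q where bq: "h = d * b" "k = d * q" unfolding d_def by (meson dvdE gcd_dvd1 gcd_dvd2)
    have dv: "k div d = q" "h div d = b" using bq d by auto
    have q: "q > 0" "b < q" using assms h bq d by auto
    have cop: "coprime b q"
      using div_gcd_coprime[of h k] assms by (simp add: dv d_def[symmetric])
    show "(case (k div gcd h k, h div gcd h k) of (q, b) \<Rightarrow> b * (k div q)) = h"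
      using q by (simp add: d_def[symmetric] dv) (simp add: bq)
    show "(k div gcd h k, h div gcd h k) \<in> Sigma {q. q dvd k} (\<lambda>q. {b. b < q \<and> coprime b q})"
      using q cop bq(2) unfolding d_def[symmetric] dv by simp
    show "(case (k div gcd h k, h div gcd h k) of (q, b) \<Rightarrow> g (real b / real q)) = g (real h / real k)"
      using d q by (simp add: d_def[symmetric] dv) (simp add: bq)
  next
    fix qb assume "qb \<in> Sigma {q. q dvd k} (\<lambda>q. {b. b < q \<and> coprime b q})"
    then obtain q b m where qb: "qb = (q, b)" "k = q * m" "b < q" "coprime b q" by auto
    have m: "m > 0" "q > 0" using assms qb by auto
    have "gcd (b * m) (q * m) = gcd b q * m" by (metis gcd_mult_distrib_nat mult.commute)
    then have g: "gcd (b * m) (q * m) = m" using qb by simp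
    show "(k div gcd (case qb of (q, b) \<Rightarrow> b * (k div q)) k,
        (case qb of (q, b) \<Rightarrow> b * (k div q)) div gcd (case qb of (q, b) \<Rightarrow> b * (k div q)) k) = qb"
      using m by (simp add: qb(1,2) g)
    show "(case qb of (q, b) \<Rightarrow> b * (k div q)) \<in> {..<k}"
      using m qb(3) by (simp add: qb(1,2))
  qed
  then show ?thesis using assms by (simp add: sum.Sigma)
qed

text \<open>
The part of the Fourier energy of \<open>F\<close> that sits at the fractions with exact denominator \<open>q\<close>.
\<close>

definition primitive_energy :: "int set \<Rightarrow> nat \<Rightarrow> real" where
  "primitive_energy F q =
    (\<Sum>b | b < q \<and> coprime b q. (cmod (exponential_sum (\<lambda>_. 1) F (real b / real q)))\<^sup>2)"

lemma primitive_energy_nonneg: "primitive_energy F q \<ge> 0"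
  unfolding primitive_energy_def by (rule sum_nonneg) simp

lemma collisions_eq_sum_primitive_energy:
  assumes "k > 0"
  shows "collisions k F F = (\<Sum>q | q dvd k. primitive_energy F q) / real k"
  using assms sum_fractions_reduced[of k "\<lambda>\<theta>. (cmod (exponential_sum (\<lambda>_. 1) F \<theta>))\<^sup>2"]
  by (simp add: collisions_eq_sum_exponential_sum primitive_energy_def)

lemma primitive_energy_le_collisions:
  assumes "q > 0"
  shows "primitive_energy F q / real q \<le> collisions q F F"
  unfolding collisions_eq_sum_primitive_energy[OF assms]
  using assms primitive_energy_nonneg
  by (intro divide_right_mono member_le_sum) auto

text \<open>
Two distinct fractions with denominators at most \<open>K\<close> differ by at least \<open>1 / K\<^sup>2 \<ge> 1 / N\<close>, so the
large sieve applies to all of them at once.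
\<close>

lemma sum_primitive_energy_le:
  assumes N: "N > 0" and F: "F \<subseteq> {a..<a + int N}" and K: "K\<^sup>2 \<le> N"
  shows "(\<Sum>q = 1..K. primitive_energy F q) \<le> exp (4 * pi) * real N * real (card F)"
proof -
  let ?I = "Sigma {1..K} (\<lambda>q. {b. b < q \<and> coprime b q})"
  let ?\<theta> = "\<lambda>(q, b). real b / real q"
  have inj: "inj_on (\<lambda>i. \<lfloor>real N * ?\<theta> i\<rfloor>) ?I"
  proof (rule inj_onI)
    fix i i' assume "i \<in> ?I" "i' \<in> ?I" and eq: "\<lfloor>real N * ?\<theta> i\<rfloor> = \<lfloor>real N * ?\<theta> i'\<rfloor>"
    then obtain q b q' b' where i: "i = (q, b)" "i' = (q', b')" "1 \<le> q" "q \<le> K" "1 \<le> q'" "q' \<le> K"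
      "coprime b q" "coprime b' q'" by auto
    have "\<bar>real N * (real b / real q) - real N * (real b' / real q')\<bar> < 1"
      using eq unfolding i by simp linarith
    then have "\<bar>real N * (real b / real q) - real N * (real b' / real q')\<bar> * (real q * real q') < 1 * (real q * real q')"
      using i by (intro mult_strict_right_mono) auto
    also have "\<bar>real N * (real b / real q) - real N * (real b' / real q')\<bar> * (real q * real q') =
        \<bar>(real N * (real b / real q) - real N * (real b' / real q')) * (real q * real q')\<bar>"
      by (simp add: abs_mult)
    also have "(real N * (real b / real q) - real N * (real b' / real q')) * (real q * real q') =
        real N * (real b * real q' - real b' * real q)"
      using i by (simp add: field_simps)
    also have "\<bar>real N * (real b * real q' - real b' * real q)\<bar> = real N * \<bar>real b * real q' - real b' * real q\<bar>"
      by (simp add: abs_mult)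
    also have "1 * (real q * real q') \<le> real N"
    proof -
      have "q * q' \<le> K * K" using i by (intro mult_mono) auto
      then have "q * q' \<le> N" using K by (simp add: power2_eq_square)
      then show ?thesis by (simp flip: of_nat_mult)
    qed
    finally have "\<bar>real b * real q' - real b' * real q\<bar> < 1" using N by simp
    then have "\<bar>real_of_int (int b * int q' - int b' * int q)\<bar> < 1" by simp
    then have "int b * int q' = int b' * int q" by linarith
    then have "b * q' = b' * q" by (metis of_nat_eq_iff of_nat_mult)
    then show "i = i'" using i coprime_crossproduct_nat[of b q b' q'] by (auto simp: mult.commute)
  qed
  have "(\<Sum>q = 1..K. primitive_energy F q) = (\<Sum>i\<in>?I. (cmod (exponential_sum (\<lambda>_. 1) F (?\<theta> i)))\<^sup>2)"
    unfolding primitive_energy_def by (subst sum.Sigma) (auto simp: case_prod_unfold)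
  also have "\<dots> \<le> exp (4 * pi) * real N * (\<Sum>x\<in>F. (1::real)\<^sup>2)"
    by (rule large_sieve[OF N F _ _ inj]) auto
  finally show ?thesis by simp
qed

lemma sum_inverse_multiples_le:
  assumes "q > 0"
  shows "(\<Sum>k | k \<in> {1..K} \<and> q dvd k. 1 / real k) \<le> harm K / real q"
proof -
  have "(\<Sum>k | k \<in> {1..K} \<and> q dvd k. 1 / real k) \<le> (\<Sum>k \<in> (\<lambda>m. q * m) ` {1..K}. 1 / real k)"
  proof (rule sum_mono2)
    show "{k. k \<in> {1..K} \<and> q dvd k} \<subseteq> (\<lambda>m. q * m) ` {1..K}"
    proof
      fix k assume "k \<in> {k. k \<in> {1..K} \<and> q dvd k}"
      then obtain m where "k = q * m" "k \<ge> 1" "k \<le> K" by auto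
      moreover from this have "m \<ge> 1" by (cases m) auto
      moreover have "m \<le> q * m" using assms by simp
      ultimately have "k = q * m" "m \<in> {1..K}" by (auto intro: le_trans[of m "q * m" K])
      then show "k \<in> (\<lambda>m. q * m) ` {1..K}" by (rule image_eqI)
    qed
  qed auto
  also have "\<dots> = (\<Sum>m\<in>{1..K}. 1 / (real q * real m))"
    using assms by (subst sum.reindex) (auto simp: inj_on_def)
  also have "\<dots> = harm K / real q"
    unfolding harm_def sum_divide_distrib by (intro sum.cong) (auto simp: field_simps)
  finally show ?thesis .
qed

text \<open>
Writing every collision count in terms of primitive energies, the energy at denominator \<open>q\<close> occurs with
total weight \<open>\<Sum> 1 / k\<close> over the multiples \<open>k \<le> K\<close> of \<open>q\<close>, which is at most \<open>harm K / q\<close>. The saving \<open>1 / q\<close>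
is used in two ways: for \<open>q \<le> Q\<close> the quotient of energy by \<open>q\<close> is at most the collision count
modulo \<open>q\<close>, and for \<open>q > Q\<close> it gives a factor \<open>1 / Q\<close> in front of the large sieve bound. Thus the
\<open>sqrt N\<close> moduli that make up the divisor function are traded for the \<open>Q\<close> smallest ones, at the price
of exactly one logarithm, which is the normalisation of the operator.
\<close>

lemma sum_collisions_le:
  assumes N: "N > 0" and F: "F \<subseteq> {a..<a + int N}" and K: "K\<^sup>2 \<le> N" and Q: "Q > 0"
  shows "(\<Sum>k = 1..K. collisions k F F) \<le>
    harm K * ((\<Sum>q = 1..Q. collisions q F F) + exp (4 * pi) * real N * real (card F) / real Q)"
proof -
  let ?S = "primitive_energy F"
  have "(\<Sum>k = 1..K. collisions k F F) = (\<Sum>k = 1..K. \<Sum>q | q \<in> {1..K} \<and> q dvd k. ?S q * (1 / real k))"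
  proof (rule sum.cong[OF refl])
    fix k assume k: "k \<in> {1..K}"
    then have "{q. q dvd k} = {q. q \<in> {1..K} \<and> q dvd k}"
      using dvd_imp_le[of _ k] by (auto simp: Suc_le_eq dvd_pos_nat intro: order_trans)
    then show "collisions k F F = (\<Sum>q | q \<in> {1..K} \<and> q dvd k. ?S q * (1 / real k))"
      using k by (simp add: collisions_eq_sum_primitive_energy sum_divide_distrib)
  qed
  also have "\<dots> = (\<Sum>q = 1..K. \<Sum>k | k \<in> {1..K} \<and> q dvd k. ?S q * (1 / real k))"
    by (rule sum.swap_restrict) auto
  also have "\<dots> \<le> (\<Sum>q = 1..K. harm K * (?S q / real q))"
  proof (rule sum_mono)
    fix q assume q: "q \<in> {1..K}"
    have "?S q * (\<Sum>k | k \<in> {1..K} \<and> q dvd k. 1 / real k) \<le> ?S q * (harm K / real q)"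
      using q by (intro mult_left_mono sum_inverse_multiples_le primitive_energy_nonneg) auto
    then show "(\<Sum>k | k \<in> {1..K} \<and> q dvd k. ?S q * (1 / real k)) \<le> harm K * (?S q / real q)"
      by (simp add: sum_distrib_left mult.commute)
  qed
  also have "\<dots> = harm K * (\<Sum>q = 1..K. ?S q / real q)"
    by (simp only: sum_distrib_left)
  also have "\<dots> \<le> harm K * ((\<Sum>q = 1..Q. collisions q F F) + exp (4 * pi) * real N * real (card F) / real Q)"
  proof (rule mult_left_mono[OF _ harm_nonneg])
    have c0: "collisions q F F \<ge> 0" for q unfolding collisions_def by (intro sum_nonneg) auto
    have "(\<Sum>q = 1..K. ?S q / real q) \<le>
        (\<Sum>q = 1..K. (if q \<in> {1..Q} then collisions q F F else 0) + ?S q / real Q)"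
    proof (rule sum_mono)
      fix q assume q: "q \<in> {1..K}"
      show "?S q / real q \<le> (if q \<in> {1..Q} then collisions q F F else 0) + ?S q / real Q"
      proof (cases "q \<le> Q")
        case True
        moreover have "?S q / real Q \<ge> 0" using primitive_energy_nonneg by simp
        ultimately show ?thesis using primitive_energy_le_collisions[of q F] q by simp
      next
        case False
        then have "?S q / real q \<le> ?S q / real Q"
          using Q q by (intro divide_left_mono primitive_energy_nonneg) auto
        then show ?thesis using False by simp
      qed
    qed
    also have "\<dots> = (\<Sum>q\<in>{1..K} \<inter> {1..Q}. collisions q F F) + (\<Sum>q = 1..K. ?S q) / real Q"
      by (simp only: sum.distrib sum_divide_distrib sum.inter_restrict[OF finite_atLeastAtMost])
    also have "\<dots> \<le> (\<Sum>q = 1..Q. collisions q F F) + exp (4 * pi) * real N * real (card F) / real Q"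
      using c0 by (intro add_mono sum_mono2 divide_right_mono sum_primitive_energy_le[OF N F K]) auto
    finally show "(\<Sum>q = 1..K. ?S q / real q) \<le>
        (\<Sum>q = 1..Q. collisions q F F) + exp (4 * pi) * real N * real (card F) / real Q" .
  qed
  finally show ?thesis .
qed

section \<open>Moments of the number of small divisors\<close>

definition small_divisor_count :: "nat \<Rightarrow> int \<Rightarrow> nat" where
  "small_divisor_count Q n = card {k\<in>{1..Q}. int k dvd n}"

text \<open>
A pair of divisors \<open>k \<le> Q\<close>, \<open>l \<le> R\<close> of \<open>n\<close> determines the divisor \<open>lcm k l \<le> Q * R\<close>, and a given value \<open>m\<close>
of the lcm arises from at most \<open>d(m)\<^sup>2\<close> pairs. In this way powers of the number of small divisors
reduce to the number of slightly larger divisors.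
\<close>

lemma small_divisor_count_mult_le:
  fixes D :: real
  assumes D: "\<And>m. 0 < m \<Longrightarrow> m \<le> Q * R \<Longrightarrow> real (divisor_count m) \<le> D"
  shows "real (small_divisor_count Q n) * real (small_divisor_count R n)
    \<le> D\<^sup>2 * real (small_divisor_count (Q * R) n)"
proof -
  let ?T = "\<lambda>Q. {k\<in>{1..Q}. int k dvd n}"
  have "?T Q \<times> ?T R \<subseteq> (\<Union>m\<in>?T (Q * R). {k. k dvd m} \<times> {l. l dvd m})"
  proof
    fix kl assume "kl \<in> ?T Q \<times> ?T R"
    then obtain k l where kl: "kl = (k, l)" "1 \<le> k" "k \<le> Q" "1 \<le> l" "l \<le> R" "int k dvd n" "int l dvd n"
      by auto
    have "lcm k l \<le> k * l" using kl by (intro dvd_imp_le) (auto simp: lcm_least)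
    also have "\<dots> \<le> Q * R" using kl by (intro mult_mono) auto
    finally have "lcm k l \<le> Q * R" .
    moreover have "lcm k l \<ge> 1" using kl by (simp add: Suc_le_eq lcm_pos_nat)
    moreover have "int (lcm k l) dvd n" using kl by (simp flip: lcm_int_int_eq)
    ultimately show "kl \<in> (\<Union>m\<in>?T (Q * R). {k. k dvd m} \<times> {l. l dvd m})"
      using kl(1) by auto
  qed
  then have "card (?T Q \<times> ?T R) \<le> card (\<Union>m\<in>?T (Q * R). {k. k dvd m} \<times> {l. l dvd m})"
    by (intro card_mono) auto
  also have "\<dots> \<le> (\<Sum>m\<in>?T (Q * R). card ({k. k dvd m} \<times> {l. l dvd m}))"
    by (rule card_UN_le) simp
  finally have "real (card (?T Q \<times> ?T R)) \<le> real (\<Sum>m\<in>?T (Q * R). card ({k. k dvd m} \<times> {l. l dvd m}))"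
    by (simp only: of_nat_le_iff)
  also have "\<dots> = (\<Sum>m\<in>?T (Q * R). (real (divisor_count m))\<^sup>2)"
    by (simp add: divisor_count_def card_cartesian_product power2_eq_square)
  also have "\<dots> \<le> (\<Sum>m\<in>?T (Q * R). D\<^sup>2)"
    by (intro sum_mono power_mono D) auto
  also have "\<dots> = D\<^sup>2 * real (small_divisor_count (Q * R) n)"
    by (simp add: small_divisor_count_def)
  finally show ?thesis by (simp add: small_divisor_count_def card_cartesian_product)
qed

lemma small_divisor_count_power_le:
  fixes D :: real
  assumes D: "\<And>m. 0 < m \<Longrightarrow> m \<le> Q ^ r \<Longrightarrow> real (divisor_count m) \<le> D" and Q: "Q > 0"
  shows "real (small_divisor_count Q n) ^ r \<le> D ^ (2 * r) * real (small_divisor_count (Q ^ r) n)"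
  using D
proof (induction r)
  case 0
  have "{k\<in>{1..1::nat}. int k dvd n} = {1}" by auto
  then show ?case by (simp add: small_divisor_count_def)
next
  case (Suc r)
  let ?t = "small_divisor_count"
  have le: "Q ^ r \<le> Q ^ Suc r" using Q by simp
  have "real (?t Q n) ^ Suc r = real (?t Q n) ^ r * real (?t Q n)" by simp
  also have "\<dots> \<le> D ^ (2 * r) * real (?t (Q ^ r) n) * real (?t Q n)"
    using Suc.prems le_trans[OF _ le] by (intro mult_right_mono Suc.IH) auto
  also have "\<dots> = D ^ (2 * r) * (real (?t (Q ^ r) n) * real (?t Q n))" by (simp only: mult.assoc)
  also have "\<dots> \<le> D ^ (2 * r) * (D\<^sup>2 * real (?t (Q ^ r * Q) n))"
    using Suc.prems
    by (intro mult_left_mono small_divisor_count_mult_le) (auto simp: mult.commute power_mult)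
  also have "\<dots> = D ^ (2 * Suc r) * real (?t (Q ^ Suc r) n)"
    by (simp add: power2_eq_square mult_ac)
  finally show ?case .
qed

lemma card_congruent_le:
  assumes "m > 0"
  shows "real (card {y\<in>{a..<a + int N}. int m dvd x - y}) \<le> real N / real m + 1"
proof -
  let ?Y = "{y\<in>{a..<a + int N}. int m dvd x - y}"
  have "inj_on (\<lambda>y. (y - a) div int m) ?Y"
  proof (rule inj_onI)
    fix y z assume yz: "y \<in> ?Y" "z \<in> ?Y" and eq: "(y - a) div int m = (z - a) div int m"
    have "int m dvd x - z" "int m dvd x - y" using yz by auto
    then have "int m dvd (x - z) - (x - y)" by (rule dvd_diff)
    then have "int m dvd (y - a) - (z - a)" by (simp add: algebra_simps)
    then have "(y - a) mod int m = (z - a) mod int m" by (simp only: mod_eq_dvd_iff)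
    with eq have "y - a = z - a" by (metis div_mult_mod_eq)
    then show "y = z" by simp
  qed
  moreover have "(\<lambda>y. (y - a) div int m) ` ?Y \<subseteq> {0..int (N div m)}"
  proof
    fix t assume "t \<in> (\<lambda>y. (y - a) div int m) ` ?Y"
    then obtain y where y: "y \<in> ?Y" "t = (y - a) div int m" by auto
    have "(y - a) div int m \<le> int N div int m" using y assms by (intro zdiv_mono1) auto
    moreover have "(y - a) div int m \<ge> 0" using y assms by (simp add: pos_imp_zdiv_nonneg_iff)
    ultimately show "t \<in> {0..int (N div m)}" using y by (simp add: zdiv_int)
  qed
  ultimately have "card ?Y \<le> card {0..int (N div m)}"
    by (intro card_inj_on_le) auto
  then have "real (card ?Y) \<le> real (N div m) + 1" by simp
  also have "real (N div m) \<le> real N / real m" by (rule of_nat_div_le_of_nat)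
  finally show ?thesis by simp
qed

text \<open>
A modulus \<open>m \<le> c * N\<close> divides \<open>x - y\<close> for at most \<open>N / m + 1 \<le> (1 + c) * N / m\<close> of the \<open>y\<close>.
\<close>

lemma sum_small_divisor_count_le:
  assumes "real M \<le> c * real N"
  shows "(\<Sum>y\<in>{a..<a + int N}. real (small_divisor_count M (x - y))) \<le> (1 + c) * real N * harm M"
proof -
  have "(\<Sum>y\<in>{a..<a + int N}. real (small_divisor_count M (x - y))) =
      (\<Sum>y\<in>{a..<a + int N}. \<Sum>m = 1..M. of_bool (int m dvd x - y))"
    unfolding small_divisor_count_def by (simp only: sum_of_bool_eq_card finite_atLeastAtMost finite_atLeastLessThan_int)
  also have "\<dots> = (\<Sum>m = 1..M. \<Sum>y\<in>{a..<a + int N}. of_bool (int m dvd x - y))"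
    by (rule sum.swap)
  also have "\<dots> = (\<Sum>m = 1..M. real (card {y\<in>{a..<a + int N}. int m dvd x - y}))"
    by (simp only: sum_of_bool_eq_card finite_atLeastAtMost finite_atLeastLessThan_int)
  also have "\<dots> \<le> (\<Sum>m = 1..M. (1 + c) * real N * inverse (real m))"
  proof (rule sum_mono)
    fix m assume m: "m \<in> {1..M}"
    have "1 \<le> c * real N / real m" using m assms by (simp add: field_simps; linarith)
    then have "real N / real m + 1 \<le> (1 + c) * real N * inverse (real m)"
      by (simp add: field_simps add_divide_distrib)
    then show "real (card {y\<in>{a..<a + int N}. int m dvd x - y}) \<le> (1 + c) * real N * inverse (real m)"
      using card_congruent_le[of m a N x] m by simp
  qed
  also have "\<dots> = (1 + c) * real N * harm M"
    by (simp add: harm_def sum_distrib_left)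
  finally show ?thesis .
qed

lemma harm_le_one_plus_ln:
  assumes "n > 0"
  shows "harm n \<le> 1 + ln (real n)"
  using euler_mascheroni_sequence_decreasing[of 1 n] assms by (simp add: harm_expand)

section \<open>Small moduli on dense sets\<close>

lemma power_mean_inequality:
  fixes u :: "'a \<Rightarrow> real"
  assumes "finite I" "\<And>i. i \<in> I \<Longrightarrow> u i \<ge> 0" "r > 0"
  shows "(\<Sum>i\<in>I. u i) ^ r \<le> real (card I) ^ (r - 1) * (\<Sum>i\<in>I. u i ^ r)"
proof (cases "I = {}")
  case False
  let ?n = "real (card I)"
  have n: "?n > 0" using False assms(1) by (simp add: card_gt_0_iff)
  have conv: "convex_on {0..} (\<lambda>x::real. x ^ r)"
  proof (cases "even r")
    case True
    then show ?thesis using convex_on_subset[OF convex_power_even[OF True]] by simp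
  qed (rule convex_power_odd)
  have "(\<Sum>i\<in>I. (1 / ?n) *\<^sub>R u i) ^ r \<le> (\<Sum>i\<in>I. (1 / ?n) * u i ^ r)"
    using n assms by (intro convex_on_sum[OF _ False conv]) auto
  then have "((\<Sum>i\<in>I. u i) / ?n) ^ r \<le> (\<Sum>i\<in>I. u i ^ r) / ?n"
    by (simp add: sum_divide_distrib)
  then have "(\<Sum>i\<in>I. u i) ^ r \<le> (\<Sum>i\<in>I. u i ^ r) / ?n * ?n ^ r"
    using n by (simp add: power_divide field_simps)
  also have "?n ^ r = ?n * ?n ^ (r - 1)" using assms(3) by (cases r) auto
  finally show ?thesis using n by (simp add: field_simps)
qed (use assms in \<open>auto simp: zero_power\<close>)

lemma sum_collisions_eq_sum_small_divisor_count:
  "(\<Sum>q = 1..Q. collisions q F F) = (\<Sum>(x, y)\<in>F \<times> F. real (small_divisor_count Q (x - y)))"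
proof -
  have "(\<Sum>q = 1..Q. collisions q F F) = (\<Sum>q = 1..Q. \<Sum>(x, y)\<in>F \<times> F. of_bool (int q dvd x - y))"
    by (simp add: collisions_def sum.cartesian_product)
  also have "\<dots> = (\<Sum>(x, y)\<in>F \<times> F. \<Sum>q = 1..Q. of_bool (int q dvd x - y))"
    unfolding case_prod_unfold by (rule sum.swap)
  finally show ?thesis
    by (simp only: small_divisor_count_def sum_of_bool_eq_card finite_atLeastAtMost)
qed

text \<open>
Hoelder's inequality with exponent \<open>r\<close> against the full interval: the \<open>r\<close>-th power of the number of
divisors up to \<open>Q\<close> is \<open>O(Q)\<close> on average there, provided that the moduli up to \<open>Q ^ r\<close> are
equidistributed in the interval, that is, \<open>Q ^ r = O(N)\<close>. With \<open>Q\<close> about the inverse of the density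
\<open>\<alpha> = card F / N\<close>, this is the assumption \<open>N ^ (r - 1) \<le> card F ^ r\<close>, i.e. \<open>\<alpha> \<ge> N powr (- 1 / r)\<close>.
After taking \<open>r\<close>-th roots, Hoelder's inequality accounts for \<open>\<alpha> powr (2 - 1 / r)\<close> and the moment for
a further \<open>Q powr (1 / r)\<close>.
\<close>

lemma sum_collisions_small_moduli_le:
  assumes r: "r > 0"
  obtains C :: real where "C \<ge> 1"
    "\<And>N a F Q. N > 0 \<Longrightarrow> F \<subseteq> {a..<a + int N} \<Longrightarrow> F \<noteq> {} \<Longrightarrow>
       real N ^ (r - 1) \<le> real (card F) ^ r \<Longrightarrow> Q > 0 \<Longrightarrow> real Q \<le> 2 * (real N / real (card F)) \<Longrightarrow>
       (\<Sum>q = 1..Q. collisions q F F) \<le> C * (real N)\<^sup>2 * (real (card F) / real N) powr (2 - 2 / real r)"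
proof -
  \<comment> \<open>This makes \<open>D ^ (2 * r) * harm (Q ^ r)\<close> of size \<open>O(Q)\<close>, since \<open>r * (2 * r + 1) * \<eta> = 1\<close>.\<close>
  define \<eta> where "\<eta> = 1 / (real r * (2 * real r + 1))"
  have \<eta>: "\<eta> > 0" using r by (simp add: \<eta>_def)
  obtain A where A: "A \<ge> 1" "\<And>n. n > 0 \<Longrightarrow> real (divisor_count n) \<le> A * real n powr \<eta>"
    using divisor_bound[OF \<eta>] by metis
  define B where "B = 2 * (1 + 2 ^ r) * A ^ (2 * r) * (1 + 1 / \<eta>)"
  have B1: "B \<ge> 1"
  proof -
    have "1 * 1 * 1 * 1 \<le> B"
      unfolding B_def using A(1) \<eta> by (intro mult_mono one_le_power) auto
    then show ?thesis by simp
  qed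
  show ?thesis
  proof
    show "B \<ge> 1" by fact
    fix N a F Q
    assume N: "N > 0" and F: "F \<subseteq> {a..<a + int N}" and ne: "F \<noteq> {}"
      and dense: "real N ^ (r - 1) \<le> real (card F) ^ r"
      and Q: "Q > 0" "real Q \<le> 2 * (real N / real (card F))"
    have fin: "finite F" using F finite_subset by blast
    define n where "n = real (card F)"
    have n: "n > 0" using fin ne by (simp add: n_def card_gt_0_iff)
    define M where "M = Q ^ r"
    have M: "M > 0" using Q by (simp add: M_def)
    define D where "D = A * real M powr \<eta>"
    have D: "real (divisor_count m) \<le> D" if "0 < m" "m \<le> M" for m
    proof -
      have "A * real m powr \<eta> \<le> D" unfolding D_def
        using that A(1) \<eta> by (intro mult_left_mono powr_mono2) auto
      then show ?thesis using A(2)[OF that(1)] by linarith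
    qed
    have D0: "D \<ge> 0" using A(1) by (simp add: D_def)
    have MN: "real M \<le> 2 ^ r * real N"
    proof -
      have "real M \<le> (2 * (real N / n)) ^ r"
        unfolding M_def of_nat_power using Q by (intro power_mono) (auto simp: n_def)
      also have "\<dots> = 2 ^ r * (real N ^ r / n ^ r)"
        by (simp add: power_mult_distrib power_divide)
      also have "real N ^ r / n ^ r \<le> real N"
      proof -
        have "real N ^ r = real N * real N ^ (r - 1)" using r by (cases r) auto
        also have "\<dots> \<le> real N * n ^ r" using dense by (intro mult_left_mono) (auto simp: n_def)
        finally show ?thesis using n by (simp add: field_simps)
      qed
      finally show ?thesis by simp
    qed
    have DH: "D ^ (2 * r) * harm M \<le> A ^ (2 * r) * (1 + 1 / \<eta>) * real Q"
    proof -
      have "harm M \<le> 1 + ln (real M)" by (rule harm_le_one_plus_ln[OF M])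
      also have "\<dots> \<le> real M powr \<eta> + real M powr \<eta> / \<eta>"
        using M \<eta> by (intro add_mono ln_powr_bound) (auto simp: ge_one_powr_ge_zero)
      also have "\<dots> = (1 + 1 / \<eta>) * real M powr \<eta>" by (simp add: field_simps)
      finally have "D ^ (2 * r) * harm M \<le> D ^ (2 * r) * ((1 + 1 / \<eta>) * real M powr \<eta>)"
        using D0 by (intro mult_left_mono) auto
      also have "\<dots> = A ^ (2 * r) * (1 + 1 / \<eta>) * real M powr (\<eta> * (2 * real r) + \<eta>)"
      proof -
        have "D ^ (2 * r) = A ^ (2 * r) * real M powr (\<eta> * (2 * real r))"
          using M by (simp add: D_def power_mult_distrib powr_power mult_ac)
        then show ?thesis by (simp add: powr_add)
      qed
      also have "\<eta> * (2 * real r) + \<eta> = 1 / real r"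
      proof -
        have "\<eta> * (2 * real r) + \<eta> = \<eta> * (2 * real r + 1)" by (simp add: algebra_simps)
        also have "2 * real r + 1 > 0" by simp
        then have "\<eta> * (2 * real r + 1) = 1 / real r" by (simp add: \<eta>_def)
        finally show ?thesis .
      qed
      also have "real M powr (1 / real r) = real Q"
        using r Q by (simp add: M_def powr_realpow[symmetric] powr_powr)
      finally show ?thesis .
    qed
    let ?t = "\<lambda>Q x y. real (small_divisor_count Q (x - y))"
    define T where "T = (\<Sum>q = 1..Q. collisions q F F)"
    have "T ^ r = (\<Sum>(x, y)\<in>F \<times> F. ?t Q x y) ^ r"
      by (simp only: T_def sum_collisions_eq_sum_small_divisor_count)
    also have "\<dots> \<le> real (card (F \<times> F)) ^ (r - 1) * (\<Sum>z\<in>F \<times> F. (case z of (x, y) \<Rightarrow> ?t Q x y) ^ r)"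
      using fin r by (intro power_mean_inequality) auto
    also have "real (card (F \<times> F)) = n\<^sup>2"
      by (simp add: n_def card_cartesian_product power2_eq_square)
    also have "(\<Sum>z\<in>F \<times> F. (case z of (x, y) \<Rightarrow> ?t Q x y) ^ r) = (\<Sum>x\<in>F. \<Sum>y\<in>F. ?t Q x y ^ r)"
      by (simp add: sum.cartesian_product case_prod_unfold)
    also have "\<dots> \<le> (\<Sum>x\<in>F. \<Sum>y\<in>{a..<a + int N}. D ^ (2 * r) * ?t M x y)"
    proof (rule sum_mono)
      fix x
      have "(\<Sum>y\<in>F. ?t Q x y ^ r) \<le> (\<Sum>y\<in>F. D ^ (2 * r) * ?t M x y)"
        unfolding M_def using D Q by (intro sum_mono small_divisor_count_power_le) (auto simp: M_def)
      also have "\<dots> \<le> (\<Sum>y\<in>{a..<a + int N}. D ^ (2 * r) * ?t M x y)"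
        using F D0 by (intro sum_mono2) auto
      finally show "(\<Sum>y\<in>F. ?t Q x y ^ r) \<le> (\<Sum>y\<in>{a..<a + int N}. D ^ (2 * r) * ?t M x y)" .
    qed
    also have "\<dots> \<le> (\<Sum>x\<in>F. D ^ (2 * r) * ((1 + 2 ^ r) * real N * harm M))"
    proof (rule sum_mono)
      fix x
      have "(\<Sum>y\<in>{a..<a + int N}. ?t M x y) \<le> (1 + 2 ^ r) * real N * harm M"
        using MN by (intro sum_small_divisor_count_le)
      then show "(\<Sum>y\<in>{a..<a + int N}. D ^ (2 * r) * ?t M x y) \<le> D ^ (2 * r) * ((1 + 2 ^ r) * real N * harm M)"
        unfolding sum_distrib_left[symmetric] using D0 by (intro mult_left_mono) auto
    qed
    also have "\<dots> = n * (1 + 2 ^ r) * real N * (D ^ (2 * r) * harm M)"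
      by (simp add: n_def)
    also have "\<dots> \<le> n * (1 + 2 ^ r) * real N * (A ^ (2 * r) * (1 + 1 / \<eta>) * real Q)"
      using DH n by (intro mult_left_mono) auto
    also have "\<dots> \<le> n * (1 + 2 ^ r) * real N * (A ^ (2 * r) * (1 + 1 / \<eta>) * (2 * (real N / n)))"
      using Q(2) n A(1) \<eta> by (intro mult_left_mono) (auto simp: n_def)
    also have "\<dots> = B * (real N)\<^sup>2"
    proof -
      define \<kappa> where "\<kappa> = 1 + 1 / \<eta>"
      show ?thesis using n by (simp add: B_def \<kappa>_def[symmetric] power2_eq_square field_simps)
    qed
    finally have Tr: "T ^ r \<le> (n\<^sup>2) ^ (r - 1) * (B * (real N)\<^sup>2)"
      using n by (simp add: mult_left_mono)
    also have "\<dots> \<le> (n\<^sup>2) ^ (r - 1) * (B ^ r * (real N)\<^sup>2)"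
      using B1 r by (intro mult_left_mono mult_right_mono self_le_power) auto
    also have "\<dots> = (B * (real N)\<^sup>2 * (n / real N) powr (2 - 2 / real r)) ^ r"
    proof -
      have "((n / real N) powr (2 - 2 / real r)) ^ r = (n / real N) powr (real (2 * (r - 1)))"
      proof -
        have "real r * (2 - 2 / real r) = real (2 * (r - 1))"
          using r by (simp add: field_simps of_nat_diff)
        then show ?thesis using n N by (subst powr_power) (simp_all only:, simp_all)
      qed
      also have "\<dots> = (n\<^sup>2) ^ (r - 1) / ((real N)\<^sup>2) ^ (r - 1)"
        using n N by (subst powr_realpow) (simp_all add: power_divide power_mult)
      finally have "(B * (real N)\<^sup>2 * (n / real N) powr (2 - 2 / real r)) ^ r =
          B ^ r * ((real N)\<^sup>2) ^ r * ((n\<^sup>2) ^ (r - 1) / ((real N)\<^sup>2) ^ (r - 1))"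
        by (simp only: power_mult_distrib)
      also have "((real N)\<^sup>2) ^ r = (real N)\<^sup>2 * ((real N)\<^sup>2) ^ (r - 1)" using r by (cases r) auto
      finally show ?thesis using N by simp
    qed
    finally have "T ^ r \<le> (B * (real N)\<^sup>2 * (n / real N) powr (2 - 2 / real r)) ^ r" .
    then have "T \<le> B * (real N)\<^sup>2 * (n / real N) powr (2 - 2 / real r)"
      using B1 r by (subst (asm) power_mono_iff) (auto simp: T_def collisions_def intro!: sum_nonneg)
    then show "(\<Sum>q = 1..Q. collisions q F F) \<le> B * (real N)\<^sup>2 * (real (card F) / real N) powr (2 - 2 / real r)"
      by (simp only: T_def n_def)
  qed
qed

section \<open>The restricted estimate\<close>

definition divisor_form :: "nat \<Rightarrow> int \<Rightarrow> (int \<Rightarrow> real) \<Rightarrow> (int \<Rightarrow> real) \<Rightarrow> real" where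
  "divisor_form N a g f =
    (\<Sum>x\<in>{a..<a + int N}. \<Sum>y\<in>{x<..<a + int N}. real (divisor_count (nat (y - x))) * (g x * f y))"

lemma divisor_form_mono:
  assumes "\<And>x. x \<in> {a..<a + int N} \<Longrightarrow> 0 \<le> g x \<and> g x \<le> g' x"
    and "\<And>x. x \<in> {a..<a + int N} \<Longrightarrow> 0 \<le> f x \<and> f x \<le> f' x"
  shows "divisor_form N a g f \<le> divisor_form N a g' f'"
  unfolding divisor_form_def
proof (intro sum_mono mult_left_mono mult_mono)
  fix x y assume x: "x \<in> {a..<a + int N}" and y: "y \<in> {x<..<a + int N}"
  then have y': "y \<in> {a..<a + int N}" by auto
  show "g x \<le> g' x" "f y \<le> f' y" "0 \<le> f y" using assms x y' by auto
  show "0 \<le> g' x" using assms(1)[OF x] by linarith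
qed auto

lemma divisor_form_sum:
  "divisor_form N a (\<lambda>x. \<Sum>i\<in>I. g i x) (\<lambda>y. \<Sum>j\<in>J. f j y) =
    (\<Sum>i\<in>I. \<Sum>j\<in>J. divisor_form N a (g i) (f j))"
proof -
  let ?X = "{a..<a + int N}" and ?d = "\<lambda>x y. real (divisor_count (nat (y - x)))"
  have "divisor_form N a (\<lambda>x. \<Sum>i\<in>I. g i x) (\<lambda>y. \<Sum>j\<in>J. f j y) =
      (\<Sum>x\<in>?X. \<Sum>y\<in>{x<..<a + int N}. \<Sum>i\<in>I. \<Sum>j\<in>J. ?d x y * (g i x * f j y))"
    unfolding divisor_form_def sum_product by (simp only: sum_distrib_left)
  also have "\<dots> = (\<Sum>x\<in>?X. \<Sum>i\<in>I. \<Sum>y\<in>{x<..<a + int N}. \<Sum>j\<in>J. ?d x y * (g i x * f j y))"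
    by (intro sum.cong refl sum.swap)
  also have "\<dots> = (\<Sum>i\<in>I. \<Sum>x\<in>?X. \<Sum>y\<in>{x<..<a + int N}. \<Sum>j\<in>J. ?d x y * (g i x * f j y))"
    by (rule sum.swap)
  also have "\<dots> = (\<Sum>i\<in>I. \<Sum>x\<in>?X. \<Sum>j\<in>J. \<Sum>y\<in>{x<..<a + int N}. ?d x y * (g i x * f j y))"
    by (intro sum.cong refl sum.swap)
  also have "\<dots> = (\<Sum>i\<in>I. \<Sum>j\<in>J. \<Sum>x\<in>?X. \<Sum>y\<in>{x<..<a + int N}. ?d x y * (g i x * f j y))"
    by (intro sum.cong refl sum.swap)
  finally show ?thesis by (simp only: divisor_form_def)
qed

lemma divisor_form_scale:
  "divisor_form N a (\<lambda>x. s * g x) (\<lambda>y. t * f y) = s * t * divisor_form N a g f"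
  unfolding divisor_form_def sum_distrib_left by (intro sum.cong refl) (simp only: mult_ac)

lemma divisor_form_indicator:
  assumes "F \<subseteq> {a..<a + int N}" "G \<subseteq> {a..<a + int N}"
  shows "divisor_form N a (\<lambda>x. of_bool (x \<in> G)) (\<lambda>y. of_bool (y \<in> F)) =
    (\<Sum>x\<in>G. \<Sum>y\<in>F. of_bool (x < y) * real (divisor_count (nat (y - x))))"
proof -
  let ?X = "{a..<a + int N}" and ?d = "\<lambda>x y. real (divisor_count (nat (y - x)))"
  have "divisor_form N a (\<lambda>x. of_bool (x \<in> G)) (\<lambda>y. of_bool (y \<in> F)) =
      (\<Sum>x\<in>?X. \<Sum>y\<in>?X. of_bool (x \<in> G) * (of_bool (y \<in> F) * (of_bool (x < y) * ?d x y)))"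
    unfolding divisor_form_def
    by (intro sum.cong refl sum.mono_neutral_cong_left) auto
  also have "\<dots> = (\<Sum>x\<in>?X. if x \<in> G then \<Sum>y\<in>F. of_bool (x < y) * ?d x y else 0)"
    using assms(1)
    by (intro sum.cong refl) (auto simp: of_bool_def intro!: sum.mono_neutral_cong_right)
  also have "\<dots> = (\<Sum>x\<in>G. \<Sum>y\<in>F. of_bool (x < y) * ?d x y)"
    using assms(2) by (simp add: sum.inter_restrict[symmetric] Int_absorb1)
  finally show ?thesis .
qed

text \<open>
The hyperbola method: of two complementary divisors of \<open>n\<close>, one is at most \<open>K\<close>.
\<close>

lemma divisor_count_le_twice_small_divisor_count:
  assumes "n > 0" "n < (K + 1)\<^sup>2"
  shows "divisor_count n \<le> 2 * small_divisor_count K (int n)"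
proof -
  let ?S = "{k\<in>{1..K}. int k dvd int n}"
  have "{k. k dvd n} \<subseteq> ?S \<union> (\<lambda>k. n div k) ` ?S"
  proof
    fix k assume "k \<in> {k. k dvd n}"
    then have k: "k dvd n" by simp
    then obtain l where l: "n = k * l" by (elim dvdE)
    have pos: "k > 0" "l > 0" using l assms(1) by auto
    show "k \<in> ?S \<union> (\<lambda>k. n div k) ` ?S"
    proof (cases "k \<le> K")
      case True
      then show ?thesis using k pos by auto
    next
      case False
      have "l \<le> K"
      proof (rule ccontr)
        assume "\<not> l \<le> K"
        then have "(K + 1) * (K + 1) \<le> k * l" using False by (intro mult_mono) auto
        then show False using assms(2) l by (simp add: power2_eq_square)
      qed
      then have "l \<in> ?S" using pos l by auto
      moreover have "k = n div l" using l pos by simp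
      ultimately show ?thesis by blast
    qed
  qed
  then have "card {k. k dvd n} \<le> card (?S \<union> (\<lambda>k. n div k) ` ?S)"
    by (intro card_mono) auto
  also have "\<dots> \<le> card ?S + card ((\<lambda>k. n div k) ` ?S)" by (rule card_Un_le)
  also have "card ((\<lambda>k. n div k) ` ?S) \<le> card ?S" by (rule card_image_le) simp
  finally show ?thesis by (simp add: divisor_count_def small_divisor_count_def)
qed

text \<open>
The cut-off \<open>Q\<close> about \<open>1 / \<alpha>\<close>, with \<open>\<alpha>\<close> the density of \<open>F\<close>, is the smallest one for which the large
sieve term \<open>N * card F / Q\<close> drops to \<open>N\<^sup>2 * \<alpha>\<^sup>2\<close>.
\<close>

lemma sum_collisions_dense_le:
  assumes r: "r > 0"
  obtains C :: real where "C \<ge> 1"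
    "\<And>N a F K. N > 0 \<Longrightarrow> F \<subseteq> {a..<a + int N} \<Longrightarrow> F \<noteq> {} \<Longrightarrow>
       real N ^ (r - 1) \<le> real (card F) ^ r \<Longrightarrow> K\<^sup>2 \<le> N \<Longrightarrow>
       (\<Sum>k = 1..K. collisions k F F) \<le> C * harm K * (real N)\<^sup>2 * (real (card F) / real N) powr (2 - 2 / real r)"
proof -
  obtain C where C: "C \<ge> 1"
    "\<And>N a F Q. N > 0 \<Longrightarrow> F \<subseteq> {a..<a + int N} \<Longrightarrow> F \<noteq> {} \<Longrightarrow>
       real N ^ (r - 1) \<le> real (card F) ^ r \<Longrightarrow> Q > 0 \<Longrightarrow> real Q \<le> 2 * (real N / real (card F)) \<Longrightarrow>
       (\<Sum>q = 1..Q. collisions q F F) \<le> C * (real N)\<^sup>2 * (real (card F) / real N) powr (2 - 2 / real r)"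
    using sum_collisions_small_moduli_le[OF r] by metis
  show ?thesis
  proof
    show "C + exp (4 * pi) \<ge> 1" using C(1) by (simp add: add_increasing2)
    fix N a F K
    assume N: "N > 0" and F: "F \<subseteq> {a..<a + int N}" and ne: "F \<noteq> {}"
      and dense: "real N ^ (r - 1) \<le> real (card F) ^ r" and K: "K\<^sup>2 \<le> N"
    have fin: "finite F" using F finite_subset by blast
    have "card F \<le> card {a..<a + int N}" using F by (intro card_mono) auto
    then have le: "card F \<le> N" by simp
    define \<alpha> where "\<alpha> = real (card F) / real N"
    have \<alpha>: "\<alpha> > 0" "\<alpha> \<le> 1" using fin ne N le by (simp_all add: \<alpha>_def card_gt_0_iff)
    define Q where "Q = nat \<lceil>1 / \<alpha>\<rceil>"
    have Q: "1 / \<alpha> \<le> real Q" "real Q \<le> 1 / \<alpha> + 1" "Q > 0"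
      using \<alpha> unfolding Q_def by (simp_all add: real_nat_ceiling_ge of_nat_ceiling)
    have "1 \<le> 1 / \<alpha>" using \<alpha> by simp
    then have Q2: "real Q \<le> 2 * (real N / real (card F))" using Q(2) by (simp add: \<alpha>_def)
    have "(\<Sum>k = 1..K. collisions k F F) \<le>
        harm K * ((\<Sum>q = 1..Q. collisions q F F) + exp (4 * pi) * real N * real (card F) / real Q)"
      by (rule sum_collisions_le[OF N F K Q(3)])
    also have "\<dots> \<le> harm K * (C * (real N)\<^sup>2 * \<alpha> powr (2 - 2 / real r) +
        exp (4 * pi) * (real N)\<^sup>2 * \<alpha> powr (2 - 2 / real r))"
    proof (intro mult_left_mono add_mono harm_nonneg)
      show "(\<Sum>q = 1..Q. collisions q F F) \<le> C * (real N)\<^sup>2 * \<alpha> powr (2 - 2 / real r)"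
        unfolding \<alpha>_def by (rule C(2)[OF N F ne dense Q(3) Q2])
      have "real (card F) / real Q \<le> real (card F) * \<alpha>"
      proof -
        have "1 / real Q \<le> \<alpha>" using Q \<alpha> by (simp add: field_simps)
        then show ?thesis using mult_left_mono[of "1 / real Q" \<alpha> "real (card F)"] by simp
      qed
      also have "\<dots> = real N * \<alpha> powr 2" using N \<alpha> by (simp add: \<alpha>_def power2_eq_square)
      also have "\<dots> \<le> real N * \<alpha> powr (2 - 2 / real r)"
        using \<alpha> by (intro mult_left_mono powr_mono') auto
      finally have "exp (4 * pi) * real N * (real (card F) / real Q) \<le>
          exp (4 * pi) * real N * (real N * \<alpha> powr (2 - 2 / real r))"
        by (intro mult_left_mono) auto
      then show "exp (4 * pi) * real N * real (card F) / real Q \<le>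
          exp (4 * pi) * (real N)\<^sup>2 * \<alpha> powr (2 - 2 / real r)"
        by (simp add: power2_eq_square mult_ac)
    qed
    finally show "(\<Sum>k = 1..K. collisions k F F) \<le>
        (C + exp (4 * pi)) * harm K * (real N)\<^sup>2 * (real (card F) / real N) powr (2 - 2 / real r)"
      by (simp add: \<alpha>_def algebra_simps)
  qed
qed

text \<open>
The main estimate, for indicator functions, with \<open>\<alpha>\<close> and \<open>\<beta>\<close> the densities of \<open>F\<close> and \<open>G\<close>. If
\<open>\<alpha> * \<beta> \<le> N powr (- 1 / r)\<close>, then the divisor bound suffices, as the loss of a small power of \<open>N\<close> is at
most the allowed loss of a power of \<open>\<alpha> * \<beta>\<close>. Otherwise both densities exceed \<open>N powr (- 1 / r)\<close>, and the
hyperbola method and the Cauchy-Schwarz inequality reduce the claim to the collision counts of \<open>F\<close> and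
of \<open>G\<close>. Treating sparse sets separately is unavoidable in this route: the diagonal pairs contribute
\<open>K * card F\<close> to a collision count although the divisor form has no diagonal.
\<close>

lemma restricted_estimate:
  assumes r: "r > 0"
  obtains C :: real where "C \<ge> 1"
    "\<And>N a F G K. N > 0 \<Longrightarrow> F \<subseteq> {a..<a + int N} \<Longrightarrow> G \<subseteq> {a..<a + int N} \<Longrightarrow>
       0 < K \<Longrightarrow> K\<^sup>2 \<le> N \<Longrightarrow> N < (K + 1)\<^sup>2 \<Longrightarrow>
       divisor_form N a (\<lambda>x. of_bool (x \<in> G)) (\<lambda>y. of_bool (y \<in> F)) \<le>
         C * harm K * (real N)\<^sup>2 * (real (card G) / real N * (real (card F) / real N)) powr (1 - 1 / real r)"
proof -
  \<comment> \<open>Then \<open>N powr \<eta>\<close> is the power \<open>- 1 / r\<close> of the threshold \<open>N powr (- 1 / r)\<close>.\<close>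
  define \<eta> where "\<eta> = 1 / real r ^ 2"
  have \<eta>: "\<eta> > 0" using r by (simp add: \<eta>_def)
  obtain A where A: "A \<ge> 1" "\<And>n. n > 0 \<Longrightarrow> real (divisor_count n) \<le> A * real n powr \<eta>"
    using divisor_bound[OF \<eta>] by metis
  obtain C where C: "C \<ge> 1"
    "\<And>N a F K. N > 0 \<Longrightarrow> F \<subseteq> {a..<a + int N} \<Longrightarrow> F \<noteq> {} \<Longrightarrow>
       real N ^ (r - 1) \<le> real (card F) ^ r \<Longrightarrow> K\<^sup>2 \<le> N \<Longrightarrow>
       (\<Sum>k = 1..K. collisions k F F) \<le> C * harm K * (real N)\<^sup>2 * (real (card F) / real N) powr (2 - 2 / real r)"
    using sum_collisions_dense_le[OF r] by metis
  show ?thesis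
  proof
    show "A + 2 * C \<ge> 1" using A C by simp
    fix N a F G K
    assume N: "N > 0" and F: "F \<subseteq> {a..<a + int N}" and G: "G \<subseteq> {a..<a + int N}"
      and K: "0 < K" "K\<^sup>2 \<le> N" "N < (K + 1)\<^sup>2"
    let ?d = "\<lambda>x y. of_bool (x < y) * real (divisor_count (nat (y - x)))"
    let ?B = "\<Sum>x\<in>G. \<Sum>y\<in>F. ?d x y"
    define \<alpha> where "\<alpha> = real (card F) / real N"
    define \<beta> where "\<beta> = real (card G) / real N"
    let ?R = "harm K * (real N)\<^sup>2 * (\<beta> * \<alpha>) powr (1 - 1 / real r)"
    have fin: "finite F" "finite G" using F G finite_subset by blast+
    have "card F \<le> card {a..<a + int N}" using F by (intro card_mono) auto
    then have \<alpha>: "0 \<le> \<alpha>" "\<alpha> \<le> 1" using N by (simp_all add: \<alpha>_def)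
    have "card G \<le> card {a..<a + int N}" using G by (intro card_mono) auto
    then have \<beta>: "0 \<le> \<beta>" "\<beta> \<le> 1" using N by (simp_all add: \<beta>_def)
    have h1: "1 \<le> (harm K :: real)" using harm_mono[of 1 K, where ?'a = real] K by (simp add: harm_expand)
    have diff: "y - x < int N" if "x \<in> G" "y \<in> F" for x y
      using that F G by (smt (verit) atLeastLessThan_iff subsetD)
    have "?B \<le> (A + 2 * C) * ?R"
    proof (cases "F = {} \<or> G = {}")
      case True
      then have "?B = 0" by auto
      moreover have "(A + 2 * C) * ?R \<ge> 0" using A C h1 by (intro mult_nonneg_nonneg) auto
      ultimately show ?thesis by linarith
    next
      case False
      then have pos: "\<alpha> > 0" "\<beta> > 0" using fin N by (simp_all add: \<alpha>_def \<beta>_def card_gt_0_iff)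
      show ?thesis
      proof (cases "\<beta> * \<alpha> \<le> real N powr (- 1 / real r)")
        case True
        have "?B \<le> (\<Sum>x\<in>G. \<Sum>y\<in>F. A * real N powr \<eta>)"
        proof (intro sum_mono)
          fix x y assume xy: "x \<in> G" "y \<in> F"
          show "?d x y \<le> A * real N powr \<eta>"
          proof (cases "x < y")
            case True
            then have "real (divisor_count (nat (y - x))) \<le> A * real (nat (y - x)) powr \<eta>" by (intro A) auto
            also have "\<dots> \<le> A * real N powr \<eta>"
              using diff[OF xy] A(1) \<eta> by (intro mult_left_mono powr_mono2) auto
            finally show ?thesis using True by simp
          qed (use A in auto)
        qed
        also have "\<dots> = A * ((real N)\<^sup>2 * ((\<beta> * \<alpha>) * real N powr \<eta>))"
          using N by (simp add: \<alpha>_def \<beta>_def power2_eq_square)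
        also have "(\<beta> * \<alpha>) * real N powr \<eta> \<le> (\<beta> * \<alpha>) powr (1 - 1 / real r)"
        proof -
          have "real N powr \<eta> = (real N powr (- 1 / real r)) powr (- 1 / real r)"
            using r by (simp add: \<eta>_def powr_powr power2_eq_square)
          also have "\<dots> \<le> (\<beta> * \<alpha>) powr (- 1 / real r)"
            using True pos r by (intro powr_mono2') auto
          finally have "(\<beta> * \<alpha>) * real N powr \<eta> \<le> (\<beta> * \<alpha>) powr 1 * (\<beta> * \<alpha>) powr (- 1 / real r)"
            using pos by (simp add: mult_left_mono)
          then show ?thesis by (simp only: powr_add[symmetric]) simp
        qed
        finally have "?B \<le> A * (1 * (real N)\<^sup>2 * (\<beta> * \<alpha>) powr (1 - 1 / real r))"
          using A by (simp add: mult_left_mono)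
        also have "\<dots> \<le> A * ?R" using A h1 by (intro mult_left_mono mult_right_mono) auto
        also have "\<dots> \<le> (A + 2 * C) * ?R" using A C h1 by (intro mult_right_mono mult_nonneg_nonneg) auto
        finally show ?thesis .
      next
        case False
        have dense: "real N ^ (r - 1) \<le> real (card H) ^ r" if "\<beta> * \<alpha> \<le> real (card H) / real N" for H :: "int set"
        proof -
          have "real N powr (- 1 / real r) \<le> real (card H) / real N" using False that by linarith
          then have "(real N powr (- 1 / real r)) ^ r \<le> (real (card H) / real N) ^ r"
            by (intro power_mono) auto
          also have "(real N powr (- 1 / real r)) ^ r = 1 / real N"
          proof -
            have "(- 1 / real r) * real r = - 1" using r by simp
            then show ?thesis using r N by (subst powr_power) (simp_all only:, simp_all add: powr_minus_divide)
          qed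
          finally have "real N ^ r / real N \<le> real (card H) ^ r"
            using N by (simp add: power_divide field_simps)
          moreover have "real N ^ r = real N * real N ^ (r - 1)" using r by (cases r) auto
          ultimately show ?thesis using N by simp
        qed
        let ?P = "\<lambda>H. \<Sum>k = 1..K. collisions k H H"
        let ?L = "\<lambda>\<gamma>. C * harm K * (real N)\<^sup>2 * \<gamma> powr (2 - 2 / real r)"
        have PF: "?P F \<le> ?L \<alpha>" unfolding \<alpha>_def
          using \<open>\<not> (F = {} \<or> G = {})\<close> \<alpha> \<beta> mult_right_mono[of \<beta> 1 \<alpha>]
          by (intro C(2)[OF N F] dense K) (auto simp: \<alpha>_def)
        have PG: "?P G \<le> ?L \<beta>" unfolding \<beta>_def
          using \<open>\<not> (F = {} \<or> G = {})\<close> \<alpha> \<beta> mult_left_mono[of \<alpha> 1 \<beta>]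
          by (intro C(2)[OF N G] dense K) (auto simp: \<beta>_def)
        have "(\<Sum>k = 1..K. collisions k G F)\<^sup>2 \<le> ?P G * ?P F"
          using fin by (intro collisions_Cauchy_Schwarz)
        also have "\<dots> \<le> ?L \<beta> * ?L \<alpha>"
          using C h1 by (intro mult_mono PF PG) (auto simp: collisions_def intro!: sum_nonneg)
        also have "\<dots> = (C * ?R)\<^sup>2"
          using pos by (simp add: power2_eq_square powr_mult mult_ac powr_add[symmetric])
        finally have "(\<Sum>k = 1..K. collisions k G F) \<le> C * ?R"
          by (rule power2_le_imp_le) (use C h1 in auto)
        moreover have "?B \<le> 2 * (\<Sum>k = 1..K. collisions k G F)"
        proof -
          have "?B \<le> (\<Sum>x\<in>G. \<Sum>y\<in>F. 2 * (\<Sum>k = 1..K. of_bool (int k dvd x - y)))"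
          proof (intro sum_mono)
            fix x y assume xy: "x \<in> G" "y \<in> F"
            show "?d x y \<le> 2 * (\<Sum>k = 1..K. of_bool (int k dvd x - y))"
            proof (cases "x < y")
              case True
              have "nat (y - x) < (K + 1)\<^sup>2" using diff[OF xy] True K(3) by linarith
              then have "divisor_count (nat (y - x)) \<le> 2 * small_divisor_count K (int (nat (y - x)))"
                using True by (intro divisor_count_le_twice_small_divisor_count) auto
              also have "int (nat (y - x)) = - (x - y)" using True by simp
              finally have "real (divisor_count (nat (y - x))) \<le> real (2 * small_divisor_count K (x - y))"
                unfolding small_divisor_count_def dvd_minus_iff by (simp only: of_nat_le_iff)
              also have "\<dots> = 2 * (\<Sum>k = 1..K. of_bool (int k dvd x - y))"
                by (simp only: small_divisor_count_def sum_of_bool_eq_card[OF finite_atLeastAtMost] of_nat_mult of_nat_numeral)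
              finally show ?thesis using True by simp
            qed (auto intro!: sum_nonneg)
          qed
          also have "\<dots> = 2 * (\<Sum>x\<in>G. \<Sum>y\<in>F. \<Sum>k = 1..K. of_bool (int k dvd x - y))"
            by (simp only: sum_distrib_left)
          also have "(\<Sum>x\<in>G. \<Sum>y\<in>F. \<Sum>k = 1..K. of_bool (int k dvd x - y)) =
              (\<Sum>x\<in>G. \<Sum>k = 1..K. \<Sum>y\<in>F. (of_bool (int k dvd x - y) :: real))"
            by (intro sum.cong refl sum.swap)
          also have "\<dots> = (\<Sum>k = 1..K. collisions k G F)"
            unfolding collisions_def by (rule sum.swap)
          finally show ?thesis .
        qed
        ultimately have "?B \<le> (2 * C) * ?R" by simp
        also have "\<dots> \<le> (A + 2 * C) * ?R" using A C h1 by (intro mult_right_mono mult_nonneg_nonneg) auto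
        finally show ?thesis .
      qed
    qed
    then show "divisor_form N a (\<lambda>x. of_bool (x \<in> G)) (\<lambda>y. of_bool (y \<in> F)) \<le>
         (A + 2 * C) * harm K * (real N)\<^sup>2 * (real (card G) / real N * (real (card F) / real N)) powr (1 - 1 / real r)"
      unfolding divisor_form_indicator[OF F G] \<alpha>_def \<beta>_def by (simp only: mult.assoc)
  qed
qed

section \<open>From sets to functions\<close>

text \<open>
The values below 2 are lumped into the level set with index 0: on a probability space they need no
further splitting. For \<open>i > 0\<close>, Chebyshev's inequality bounds the density of \<open>{2 ^ i \<le> f < 2 ^ (i + 1)}\<close>
by \<open>2 powr (- i * p)\<close>, and \<open>p * s > 1\<close> makes the sum geometric.
\<close>

lemma level_set_decomposition:
  fixes f :: "int \<Rightarrow> real" and p s :: real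
  assumes N: "N > 0" and f: "\<And>x. x \<in> {a..<a + int N} \<Longrightarrow> f x \<ge> 0" and p: "p > 0" and s: "s > 0" "p * s > 1"
    and norm: "(\<Sum>x\<in>{a..<a + int N}. f x powr p) \<le> real N"
  obtains L F where "\<And>i. F i \<subseteq> {a..<a + int N}"
    "\<And>x. x \<in> {a..<a + int N} \<Longrightarrow> f x \<le> (\<Sum>i<L. 2 ^ Suc i * of_bool (x \<in> F i))"
    "(\<Sum>i<L. 2 ^ Suc i * (real (card (F i)) / real N) powr s) \<le> 2 / (1 - 2 powr (1 - p * s))"
proof -
  let ?E = "{a..<a + int N}"
  define F where "F i = {x\<in>?E. (if i = 0 then 0 else 2 ^ i) \<le> f x \<and> f x < 2 ^ Suc i}" for i :: nat
  obtain L where L: "(\<Sum>x\<in>?E. f x) < 2 ^ L" using real_arch_pow[of 2] by auto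
  have fL: "f x < 2 ^ L" if "x \<in> ?E" for x
    using member_le_sum[of x ?E f] f that L by auto
  show ?thesis
  proof
    show "F i \<subseteq> ?E" for i by (auto simp: F_def)
    fix x assume x: "x \<in> ?E"
    define i where "i = (LEAST i. f x < 2 ^ Suc i)"
    have ex: "f x < 2 ^ Suc L" by (rule less_le_trans[OF fL[OF x]]) simp
    have i1: "f x < 2 ^ Suc i" unfolding i_def using ex by (rule LeastI)
    have i2: "(if i = 0 then 0 else 2 ^ i) \<le> f x"
    proof (cases i)
      case 0
      then show ?thesis using f[OF x] by simp
    next
      case (Suc j)
      then have "\<not> f x < 2 ^ Suc j" unfolding i_def by (metis lessI not_less_Least)
      then show ?thesis using Suc by simp
    qed
    have "i < L \<or> L = 0"
    proof (rule ccontr)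
      assume *: "\<not> (i < L \<or> L = 0)"
      then obtain j where j: "i = Suc j" by (cases i) auto
      have "(2::real) ^ L \<le> 2 ^ i" using * by (intro power_increasing) auto
      then show False using i2 j fL[OF x] by simp
    qed
    show "f x \<le> (\<Sum>i<Suc L. 2 ^ Suc i * of_bool (x \<in> F i))"
    proof -
      have iL: "i \<in> {..<Suc L}"
        using \<open>i < L \<or> L = 0\<close> Least_le[of "\<lambda>i. f x < 2 ^ Suc i" L, OF ex] by (auto simp: i_def)
      have "f x \<le> 2 ^ Suc i * of_bool (x \<in> F i)" using i1 i2 x by (simp add: F_def)
      also have "\<dots> \<le> (\<Sum>i<Suc L. 2 ^ Suc i * of_bool (x \<in> F i))"
        using iL by (intro member_le_sum) auto
      finally show ?thesis .
    qed
  next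
    have dens: "real (card (F i)) / real N \<le> 2 powr (- real i * p)" for i
    proof (cases "i = 0")
      case True
      have "card (F i) \<le> card ?E" by (intro card_mono) (auto simp: F_def)
      then show ?thesis using True N by simp
    next
      case False
      have "real (card (F i)) * (2 ^ i) powr p = (\<Sum>x\<in>F i. (2 ^ i) powr p)" by simp
      also have "\<dots> \<le> (\<Sum>x\<in>F i. f x powr p)"
        using False p by (intro sum_mono powr_mono2) (auto simp: F_def)
      also have "\<dots> \<le> (\<Sum>x\<in>?E. f x powr p)"
        by (intro sum_mono2) (auto simp: F_def)
      also have "\<dots> \<le> real N" by fact
      also have "(2 ^ i) powr p = (2::real) powr (real i * p)"
        by (simp add: powr_realpow[symmetric] powr_powr)
      finally show ?thesis using N by (simp add: powr_minus field_simps)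
    qed
    define \<rho> where "\<rho> = (2::real) powr (1 - p * s)"
    have \<rho>: "0 < \<rho>" "\<rho> < 1"
      using powr_less_mono[of "1 - p * s" 0 "2 :: real"] s by (simp_all add: \<rho>_def)
    have "(\<Sum>i<Suc L. 2 ^ Suc i * (real (card (F i)) / real N) powr s) \<le> (\<Sum>i<Suc L. 2 * \<rho> ^ i)"
    proof (rule sum_mono)
      fix i
      have "2 ^ Suc i * (real (card (F i)) / real N) powr s \<le> 2 ^ Suc i * (2 powr (- real i * p)) powr s"
        using dens s by (intro mult_left_mono powr_mono2) auto
      also have "\<dots> = 2 * (2 powr real i * 2 powr (- real i * p * s))"
        by (simp add: powr_realpow powr_powr)
      also have "2 powr real i * 2 powr (- real i * p * s) = (2::real) powr (real i * (1 - p * s))"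
        by (simp only: powr_add[symmetric]) (simp add: algebra_simps)
      also have "\<dots> = \<rho> ^ i" by (simp add: \<rho>_def powr_power mult.commute)
      finally show "2 ^ Suc i * (real (card (F i)) / real N) powr s \<le> 2 * \<rho> ^ i" .
    qed
    also have "\<dots> = 2 * (\<Sum>i<Suc L. \<rho> ^ i)" by (simp only: sum_distrib_left)
    also have "(\<Sum>i<Suc L. \<rho> ^ i) \<le> 1 / (1 - \<rho>)"
      using \<rho> by (subst sum_gp_strict) (auto simp: divide_simps)
    finally show "(\<Sum>i<Suc L. 2 ^ Suc i * (real (card (F i)) / real N) powr s) \<le> 2 / (1 - 2 powr (1 - p * s))"
      by (simp add: \<rho>_def)
  qed
qed

text \<open>
Interpolation is elementary on a space of finite measure: the restricted estimate with the exponent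
\<open>s = 1 - 1 / r\<close>, for any \<open>r\<close> with \<open>p * s > 1\<close>, gives the strong estimate at \<open>p\<close> by decomposing
both functions into level sets.
\<close>

lemma divisor_form_bounded:
  fixes p :: real
  assumes p: "1 < p"
  obtains C :: real where "C > 0"
    "\<And>N a f g K. N > 0 \<Longrightarrow> 0 < K \<Longrightarrow> K\<^sup>2 \<le> N \<Longrightarrow> N < (K + 1)\<^sup>2 \<Longrightarrow>
       (\<And>x. x \<in> {a..<a + int N} \<Longrightarrow> g x \<ge> 0) \<Longrightarrow> (\<And>x. x \<in> {a..<a + int N} \<Longrightarrow> f x \<ge> 0) \<Longrightarrow>
       divisor_form N a g f \<le> C * harm K * (real N)\<^sup>2 *
         ((\<Sum>x\<in>{a..<a + int N}. g x powr p) / real N) powr (1 / p) *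
         ((\<Sum>x\<in>{a..<a + int N}. f x powr p) / real N) powr (1 / p)"
proof -
  obtain r where r: "real r > p / (p - 1)" using reals_Archimedean2 by blast
  have "p / (p - 1) > 1" using p by simp
  then have r1: "real r > 1" using r by linarith
  then have r0: "r > 0" by simp
  define s where "s = 1 - 1 / real r"
  have s: "s > 0" "p * s > 1" using r r1 p by (simp_all add: s_def field_simps)
  obtain A where A: "A \<ge> 1"
    "\<And>N a F G K. N > 0 \<Longrightarrow> F \<subseteq> {a..<a + int N} \<Longrightarrow> G \<subseteq> {a..<a + int N} \<Longrightarrow>
       0 < K \<Longrightarrow> K\<^sup>2 \<le> N \<Longrightarrow> N < (K + 1)\<^sup>2 \<Longrightarrow>
       divisor_form N a (\<lambda>x. of_bool (x \<in> G)) (\<lambda>y. of_bool (y \<in> F)) \<le>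
         A * harm K * (real N)\<^sup>2 * (real (card G) / real N * (real (card F) / real N)) powr s"
  proof (rule restricted_estimate[OF r0, folded s_def], goal_cases)
    case (1 C)
    from 1(2,3) show thesis by (rule 1(1))
  qed
  define c where "c = 2 / (1 - 2 powr (1 - p * s))"
  have c: "c > 0" using powr_less_mono[of "1 - p * s" 0 "2 :: real"] s by (simp add: c_def)
  have unit: "divisor_form N a g f \<le> A * c\<^sup>2 * harm K * (real N)\<^sup>2"
    if N: "N > 0" and K: "0 < K" "K\<^sup>2 \<le> N" "N < (K + 1)\<^sup>2"
      and g: "\<And>x. x \<in> {a..<a + int N} \<Longrightarrow> g x \<ge> 0" "(\<Sum>x\<in>{a..<a + int N}. g x powr p) \<le> real N"
      and f: "\<And>x. x \<in> {a..<a + int N} \<Longrightarrow> f x \<ge> 0" "(\<Sum>x\<in>{a..<a + int N}. f x powr p) \<le> real N"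
    for N K a f g
  proof -
    have p0: "p > 0" using p by simp
    obtain L F where F: "\<And>i. F i \<subseteq> {a..<a + int N}"
      "\<And>x. x \<in> {a..<a + int N} \<Longrightarrow> f x \<le> (\<Sum>i<L. 2 ^ Suc i * of_bool (x \<in> F i))"
      "(\<Sum>i<L. 2 ^ Suc i * (real (card (F i)) / real N) powr s) \<le> c"
    proof (rule level_set_decomposition[OF N _ p0 s f(2), folded c_def], goal_cases)
      case 1
      from 1(2) show ?case by (rule f(1))
    next
      case 2
      from 2(2-) show thesis by (rule 2(1))
    qed
    obtain M G where G: "\<And>i. G i \<subseteq> {a..<a + int N}"
      "\<And>x. x \<in> {a..<a + int N} \<Longrightarrow> g x \<le> (\<Sum>i<M. 2 ^ Suc i * of_bool (x \<in> G i))"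
      "(\<Sum>i<M. 2 ^ Suc i * (real (card (G i)) / real N) powr s) \<le> c"
    proof (rule level_set_decomposition[OF N _ p0 s g(2), folded c_def], goal_cases)
      case 1
      from 1(2) show ?case by (rule g(1))
    next
      case 2
      from 2(2-) show thesis by (rule 2(1))
    qed
    let ?u = "\<lambda>i. 2 ^ Suc i * (real (card (G i)) / real N) powr s"
    let ?v = "\<lambda>j. 2 ^ Suc j * (real (card (F j)) / real N) powr s"
    have h0: "harm K \<ge> (0::real)" by (rule harm_nonneg)
    have "divisor_form N a g f \<le> divisor_form N a
        (\<lambda>x. \<Sum>i<M. 2 ^ Suc i * of_bool (x \<in> G i)) (\<lambda>y. \<Sum>j<L. 2 ^ Suc j * of_bool (y \<in> F j))"
      using f(1) g(1) F(2) G(2) by (intro divisor_form_mono) auto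
    also have "\<dots> = (\<Sum>i<M. \<Sum>j<L. 2 ^ Suc i * 2 ^ Suc j *
        divisor_form N a (\<lambda>x. of_bool (x \<in> G i)) (\<lambda>y. of_bool (y \<in> F j)))"
      by (simp only: divisor_form_sum divisor_form_scale)
    also have "\<dots> \<le> (\<Sum>i<M. \<Sum>j<L. 2 ^ Suc i * 2 ^ Suc j *
        (A * harm K * (real N)\<^sup>2 * (real (card (G i)) / real N * (real (card (F j)) / real N)) powr s))"
      by (intro sum_mono mult_left_mono A(2)[OF N F(1) G(1) K]) auto
    also have "\<dots> = (\<Sum>i<M. \<Sum>j<L. A * harm K * (real N)\<^sup>2 * (?u i * ?v j))"
      by (intro sum.cong refl) (simp add: powr_mult powr_divide mult_ac)
    also have "\<dots> = A * harm K * (real N)\<^sup>2 * (sum ?u {..<M} * sum ?v {..<L})"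
      unfolding sum_product by (simp only: sum_distrib_left)
    also have "\<dots> \<le> A * harm K * (real N)\<^sup>2 * (c * c)"
      using A(1) F(3) G(3) h0 c by (intro mult_left_mono mult_mono) (auto intro!: sum_nonneg)
    finally show ?thesis by (simp add: power2_eq_square mult_ac)
  qed
  show ?thesis
  proof
    show "A * c\<^sup>2 > 0" using A(1) c by simp
    fix N a f g K
    assume N: "N > 0" and K: "0 < K" "K\<^sup>2 \<le> N" "N < (K + 1)\<^sup>2"
      and g: "\<And>x. x \<in> {a..<a + int N} \<Longrightarrow> g x \<ge> (0::real)"
      and f: "\<And>x. x \<in> {a..<a + int N} \<Longrightarrow> f x \<ge> (0::real)"
    let ?E = "{a..<a + int N}"
    define n where "n f = ((\<Sum>x\<in>?E. f x powr p) / real N) powr (1 / p)" for f :: "int \<Rightarrow> real"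
    have n_nonneg: "n f \<ge> 0" for f by (simp add: n_def)
    have n0: "f x = 0" if "n f = 0" "x \<in> ?E" for f x
    proof -
      have "(\<Sum>x\<in>?E. f x powr p) = 0" using that(1) N by (simp add: n_def)
      moreover have "(\<Sum>x\<in>?E. f x powr p) = 0 \<longleftrightarrow> (\<forall>x\<in>?E. f x powr p = 0)"
        by (rule sum_nonneg_eq_0_iff) auto
      ultimately show ?thesis using that(2) by simp
    qed
    have scaled: "(\<Sum>x\<in>?E. (f x / n f) powr p) \<le> real N"
      if "n f \<noteq> 0" for f
    proof -
      define S where "S = (\<Sum>x\<in>?E. f x powr p)"
      have S: "S \<noteq> 0" using that by (auto simp: n_def S_def)
      have "S \<ge> 0" unfolding S_def by (intro sum_nonneg) auto
      then have npow: "n f powr p = S / real N"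
        using p N by (simp add: n_def S_def[symmetric] powr_powr)
      have "(\<Sum>x\<in>?E. (f x / n f) powr p) = (\<Sum>x\<in>?E. f x powr p / n f powr p)"
        by (intro sum.cong refl powr_divide)
      also have "\<dots> = S / n f powr p" by (simp only: S_def sum_divide_distrib)
      finally show ?thesis using S by (simp add: npow)
    qed
    have "divisor_form N a g f \<le> A * c\<^sup>2 * harm K * (real N)\<^sup>2 * n g * n f"
    proof (cases "n g = 0 \<or> n f = 0")
      case True
      have "g x * f y = 0" if "x \<in> ?E" "y \<in> ?E" for x y
        using True n0[of g, OF _ that(1)] n0[of f, OF _ that(2)] by auto
      then have "divisor_form N a g f = 0"
        unfolding divisor_form_def by (intro sum.neutral ballI) simp
      then show ?thesis using True by auto
    next
      case False
      have pos: "n g > 0" "n f > 0" using False n_nonneg[of g] n_nonneg[of f] by auto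
      have "divisor_form N a g f = divisor_form N a (\<lambda>x. n g * (g x / n g)) (\<lambda>x. n f * (f x / n f))"
        using False by simp
      also have "\<dots> = n g * n f * divisor_form N a (\<lambda>x. g x / n g) (\<lambda>x. f x / n f)"
        by (rule divisor_form_scale)
      also have "\<dots> \<le> n g * n f * (A * c\<^sup>2 * harm K * (real N)\<^sup>2)"
      proof (rule mult_left_mono)
        show "divisor_form N a (\<lambda>x. g x / n g) (\<lambda>x. f x / n f) \<le> A * c\<^sup>2 * harm K * (real N)\<^sup>2"
          using False f g pos by (intro unit[OF N K] scaled divide_nonneg_pos) auto
      qed (use pos in auto)
      finally show ?thesis by (simp only: mult_ac)
    qed
    then show "divisor_form N a g f \<le> A * c\<^sup>2 * harm K * (real N)\<^sup>2 *
        ((\<Sum>x\<in>?E. g x powr p) / real N) powr (1 / p) * ((\<Sum>x\<in>?E. f x powr p) / real N) powr (1 / p)"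
      by (simp only: n_def)
  qed
qed

section \<open>The averaging operator\<close>

text \<open>
Counting only the divisors up to \<open>K\<close>; the average of \<open>d\<close> is thus at least \<open>harm K / 2\<close>, which absorbs
the logarithm lost in the bound for the divisor form.
\<close>

lemma divisor_summatory_ge:
  assumes "K \<le> N"
  shows "real N * harm K \<le> 2 * real (divisor_summatory N)"
proof -
  have "real N * harm K = (\<Sum>k = 1..K. real N / real k)"
    by (simp add: harm_def sum_distrib_left divide_inverse)
  also have "\<dots> \<le> (\<Sum>k = 1..K. 2 * real (card {n\<in>{1..N}. k dvd n}))"
  proof (rule sum_mono)
    fix k assume k: "k \<in> {1..K}"
    have "(\<lambda>m. k * m) ` {1..N div k} \<subseteq> {n\<in>{1..N}. k dvd n}"
    proof
      fix n assume "n \<in> (\<lambda>m. k * m) ` {1..N div k}"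
      then obtain m where "n = k * m" "m \<in> {1..N div k}" by (rule imageE)
      then have m: "n = k * m" "1 \<le> m" "m \<le> N div k" by simp_all
      then have "k * m \<le> N" using times_div_less_eq_dividend[of k N] by (meson le_trans mult_le_mono2)
      then show "n \<in> {n\<in>{1..N}. k dvd n}" using m k by auto
    qed
    then have "card ((\<lambda>m. k * m) ` {1..N div k}) \<le> card {n\<in>{1..N}. k dvd n}" by (intro card_mono) auto
    moreover have "card ((\<lambda>m. k * m) ` {1..N div k}) = N div k"
      using k by (subst card_image) (auto simp: inj_on_def)
    ultimately have 1: "real (N div k) \<le> real (card {n\<in>{1..N}. k dvd n})" by simp
    have "N div k \<ge> 1" using k assms by (simp add: Suc_le_eq div_greater_zero_iff)
    have "k * 1 \<le> k * (N div k)" using \<open>N div k \<ge> 1\<close> by (rule mult_le_mono2)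
    moreover have "N mod k < k" using k by simp
    ultimately have "N \<le> 2 * (k * (N div k))" using mult_div_mod_eq[of k N] by linarith
    then have "N \<le> 2 * (N div k) * k" by (simp only: mult_ac)
    then have "real N \<le> 2 * real (N div k) * real k" by (metis of_nat_mono of_nat_mult of_nat_numeral)
    then have "real N / real k \<le> 2 * real (N div k)" using k by (simp add: field_simps)
    then show "real N / real k \<le> 2 * real (card {n\<in>{1..N}. k dvd n})" using 1 by linarith
  qed
  also have "\<dots> = 2 * (\<Sum>k = 1..K. \<Sum>n = 1..N. of_bool (k dvd n))"
    by (simp only: sum_distrib_left sum_of_bool_eq_card finite_atLeastAtMost)
  also have "(\<Sum>k = 1..K. \<Sum>n = 1..N. of_bool (k dvd n)) = (\<Sum>n = 1..N. \<Sum>k = 1..K. (of_bool (k dvd n) :: real))"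
    by (rule sum.swap)
  also have "\<dots> = (\<Sum>n = 1..N. real (card {k\<in>{1..K}. k dvd n}))"
    by (simp only: sum_of_bool_eq_card finite_atLeastAtMost)
  also have "\<dots> \<le> (\<Sum>n = 1..N. real (divisor_count n))"
    unfolding divisor_count_def by (intro sum_mono of_nat_mono card_mono) auto
  finally show ?thesis by (simp add: divisor_summatory_def)
qed

lemma norm_divisor_average_le:
  assumes supp: "{x. f x \<noteq> 0} \<subseteq> {a..<a + int N}" and x: "x \<in> {a..<a + int N}"
  shows "cmod (divisor_average N f x) \<le>
    (\<Sum>y\<in>{x<..<a + int N}. real (divisor_count (nat (y - x))) * cmod (f y)) / real (divisor_summatory N)"
proof -
  have "cmod (\<Sum>n = 1..N. of_nat (divisor_count n) * f (x + int n)) \<le>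
      (\<Sum>n = 1..N. real (divisor_count n) * cmod (f (x + int n)))"
    by (rule order_trans[OF norm_sum]) (simp add: norm_mult)
  also have "\<dots> = (\<Sum>y\<in>{x<..x + int N}. real (divisor_count (nat (y - x))) * cmod (f y))"
    by (rule sum.reindex_bij_witness[where i = "\<lambda>y. nat (y - x)" and j = "\<lambda>n. x + int n"]) auto
  also have "\<dots> = (\<Sum>y\<in>{x<..<a + int N}. real (divisor_count (nat (y - x))) * cmod (f y))"
    using supp x by (intro sum.mono_neutral_right) auto
  finally have "cmod (\<Sum>n = 1..N. of_nat (divisor_count n) * f (x + int n)) / real (divisor_summatory N) \<le>
      (\<Sum>y\<in>{x<..<a + int N}. real (divisor_count (nat (y - x))) * cmod (f y)) / real (divisor_summatory N)"
    by (rule divide_right_mono) simp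
  then show ?thesis by (simp add: divisor_average_def norm_mult norm_divide)
qed

text \<open>
Duality: pair \<open>u = \<bar>K\<^sub>N f\<bar>\<close> with \<open>u powr (p' - 1)\<close>. Since \<open>(p' - 1) * p = p'\<close>, the \<open>p\<close>-norm of the latter
is again a power of the \<open>p'\<close>-norm of \<open>u\<close>, all but one factor of which then cancels.
\<close>

theorem theorem1p1:
  fixes p p' :: real
  assumes "1 < p" and "p < 2" and "1 / p + 1 / p' = 1"
  shows "\<exists>C::real. C > 0 \<and>
    (\<forall>(N::nat) (E::int set) (f::int \<Rightarrow> complex).
       N > 0 \<longrightarrow> integer_interval E \<longrightarrow> card E = N \<longrightarrow> {x. f x \<noteq> 0} \<subseteq> E \<longrightarrow>
       lp_average (divisor_average N f) E p' \<le> C * lp_average f E p)"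
proof -
  have p0: "p > 0" using assms by simp
  have p'0: "p' \<noteq> 0" using assms by (cases "p' = 0") auto
  have pp: "p + p' = p * p'" using assms(3) p0 p'0 by (simp add: field_simps)
  have "p' * (p - 1) = p" using pp by (simp add: algebra_simps)
  then have "p' > 0" using assms p0 by (smt (verit) mult_nonpos_nonneg)
  have conj: "(p' - 1) * p = p'" using pp by (simp add: algebra_simps)
  obtain C where C: "C > 0"
    "\<And>N a f g K. N > 0 \<Longrightarrow> 0 < K \<Longrightarrow> K\<^sup>2 \<le> N \<Longrightarrow> N < (K + 1)\<^sup>2 \<Longrightarrow>
       (\<And>x. x \<in> {a..<a + int N} \<Longrightarrow> g x \<ge> 0) \<Longrightarrow> (\<And>x. x \<in> {a..<a + int N} \<Longrightarrow> f x \<ge> 0) \<Longrightarrow>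
       divisor_form N a g f \<le> C * harm K * (real N)\<^sup>2 *
         ((\<Sum>x\<in>{a..<a + int N}. g x powr p) / real N) powr (1 / p) *
         ((\<Sum>x\<in>{a..<a + int N}. f x powr p) / real N) powr (1 / p)"
    using divisor_form_bounded[OF assms(1)] by metis
  have "lp_average (divisor_average N f) E p' \<le> 2 * C * lp_average f E p"
    if N: "N > 0" and int: "integer_interval E" and card: "card E = N" and supp: "{x. f x \<noteq> 0} \<subseteq> E"
    for N E f
  proof -
    obtain a b where "E = {a..b}" using int by (auto simp: integer_interval_def)
    then have E: "E = {a..<a + int N}" using card N by auto
    \<comment> \<open>The cut-off of the hyperbola method.\<close>
    define K where "K = nat \<lfloor>sqrt (real N)\<rfloor>"
    have K: "0 < K" "K\<^sup>2 \<le> N" "N < (K + 1)\<^sup>2"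
    proof -
      have "sqrt (real N) \<ge> 1" using N by simp
      then have k: "real K \<le> sqrt (real N)" "sqrt (real N) < real K + 1" "K > 0"
        unfolding K_def by (simp_all add: le_nat_floor)
      show "0 < K" by fact
      have "(real K)\<^sup>2 \<le> (sqrt (real N))\<^sup>2" using k by (intro power_mono) auto
      then have "real (K\<^sup>2) \<le> real N" by simp
      then show "K\<^sup>2 \<le> N" by (simp only: of_nat_le_iff)
      have "(sqrt (real N))\<^sup>2 < (real K + 1)\<^sup>2" using k by (intro power_strict_mono) auto
      then have "real N < real ((K + 1)\<^sup>2)" by (simp add: add.commute)
      then show "N < (K + 1)\<^sup>2" by (simp only: of_nat_less_iff)
    qed
    have KN: "K \<le> N" using K(2) self_le_power[of K 2] K(1) by (auto intro: order_trans)
    define h where "h = (harm K :: real)"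
    have h: "h > 0" using K(1) by (simp add: h_def)
    define D where "D = real (divisor_summatory N)"
    have D: "real N * h \<le> 2 * D" unfolding D_def h_def by (rule divisor_summatory_ge[OF KN])
    then have D0: "D > 0" using h N by (smt (verit) mult_pos_pos of_nat_0_less_iff)
    define u where "u x = cmod (divisor_average N f x)" for x
    define S where "S = (\<Sum>x\<in>E. u x powr p')"
    have S0: "S \<ge> 0" unfolding S_def by (intro sum_nonneg) auto
    define A where "A = lp_average f E p"
    have A: "A = ((\<Sum>x\<in>E. cmod (f x) powr p) / real N) powr (1 / p)"
      by (simp add: A_def lp_average_def card)
    have "S \<le> (\<Sum>x\<in>E. u x powr (p' - 1) *
        ((\<Sum>y\<in>{x<..<a + int N}. real (divisor_count (nat (y - x))) * cmod (f y)) / D))"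
      unfolding S_def
    proof (rule sum_mono)
      fix x assume x: "x \<in> E"
      have "u x powr p' = u x powr (p' - 1) * u x"
        by (cases "u x = 0") (simp_all add: powr_diff u_def)
      also have "\<dots> \<le> u x powr (p' - 1) *
        ((\<Sum>y\<in>{x<..<a + int N}. real (divisor_count (nat (y - x))) * cmod (f y)) / D)"
        unfolding D_def u_def using supp x E by (intro mult_left_mono norm_divisor_average_le) auto
      finally show "u x powr p' \<le> u x powr (p' - 1) *
        ((\<Sum>y\<in>{x<..<a + int N}. real (divisor_count (nat (y - x))) * cmod (f y)) / D)" .
    qed
    also have "\<dots> = divisor_form N a (\<lambda>x. u x powr (p' - 1)) (\<lambda>y. cmod (f y)) / D"
      unfolding divisor_form_def E by (simp add: sum_distrib_left sum_divide_distrib mult_ac)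
    also have "\<dots> \<le> C * h * (real N)\<^sup>2 *
         ((\<Sum>x\<in>E. (u x powr (p' - 1)) powr p) / real N) powr (1 / p) * A / D"
      unfolding A h_def E using D0 by (intro divide_right_mono C(2)[OF N K]) auto
    also have "\<dots> = C * h * (real N)\<^sup>2 * (S / real N) powr (1 / p) * A / D"
      by (simp add: powr_powr conj S_def)
    also have "\<dots> = C * real N * (S / real N) powr (1 / p) * A * (real N * h / D)"
      by (simp add: power2_eq_square)
    also have "\<dots> \<le> C * real N * (S / real N) powr (1 / p) * A * 2"
      using D D0 C(1) by (intro mult_left_mono mult_nonneg_nonneg) (auto simp: A field_simps)
    finally have SS: "S \<le> 2 * C * A * real N * (S / real N) powr (1 / p)" by (simp add: mult_ac)
    have "(S / real N) powr (1 / p') \<le> 2 * C * A"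
    proof (cases "S = 0")
      case True
      then show ?thesis using C(1) by (simp add: A)
    next
      case False
      define q where "q = (S / real N) powr (1 / p)"
      have q: "q > 0" using False S0 N by (simp add: q_def)
      have "S / real N = (S / real N) powr (1 / p' + 1 / p)"
        using assms(3) S0 by (simp add: add.commute)
      also have "\<dots> = (S / real N) powr (1 / p') * q" by (simp only: powr_add q_def)
      finally have "(S / real N) powr (1 / p') * q = S / real N" by simp
      also have "\<dots> \<le> 2 * C * A * q" using SS N by (simp add: q_def field_simps)
      finally show ?thesis using q by simp
    qed
    then show ?thesis by (simp add: lp_average_def card A_def S_def u_def)
  qed
  then show ?thesis using C(1) by (intro exI[of _ "2 * C"]) auto
qed

end
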